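(* Let $S\in\tfrac12\mathbb{N}$, $\theta=2S+1$, and $\beta>0$. With $Z_n(\beta)=\mathrm{tr}\big(e^{-(\beta/n)H_n}\big)$ and $\phi_\beta$, $\Delta$ as in the context, \[ \lim_{n\to\infty}\frac1n\log Z_n(\beta)=\max_{x\in\Delta}\phi_\beta(x). \]
   Context: Let $S^1,S^2,S^3$ be the spin-$S$ operators on $\mathcal H=\mathbb{C}^{2S+1}$, and let $\{|a\rangle: a\in\{-S,-S+1,\dots,S\}\}$ be the orthonormal basis of eigenvectors of $S^3$ ($S^3|a\rangle=a|a\rangle$). Let $V=\{1,\dots,n\}$ and $E$ the set of all unordered pairs $xy$ of distinct vertices (the complete graph $K_n$). Let $\mathcal H_V=\bigotimes_{x\in V}\mathcal H_x$, each $\mathcal H_x$ a copy of $\mathcal H$, with basis $|\mathbf a\rangle=\otimes_{x\in V}|a_x\rangle$, $\mathbf a\in\{-S,\dots,S\}^V$. For $x\neq y$ the transposition operator $T_{xy}$ is defined by $T_{xy}\otimes_{z}|a_z\rangle=\otimes_z|a_{\tau(z)}\rangle$ where $\tau$ is the transposition of $x$ and $y$. Let $H_n=-\sum_{xy\in E}(T_{xy}-1)$. Let $\Delta=\{x\in[0,1]^\theta: x_1\ge\dots\ge x_\theta,\ \sum_{j=1}^\theta x_j=1\}$ and $\phi_\beta(x)=\frac\beta2\big(\sum_{j=1}^\theta x_j^2-1\big)-\sum_{j=1}^\theta x_j\log x_j$ (with $0\log 0=0$). *)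

theory Defs
  imports Complex_Main "HOL-Library.FuncSet"
begin

definition theta :: "real \<Rightarrow> nat" where
  "theta S = nat \<lfloor>2 * S\<rfloor> + 1"

definition spins :: "real \<Rightarrow> real set" where
  "spins S = {- S + real j | j. j < theta S}"

definition configs :: "real \<Rightarrow> nat \<Rightarrow> (nat \<Rightarrow> real) set" where
  "configs S n = PiE {1..n} (\<lambda>_. spins S)"

(* Edges of the complete graph K_n: unordered pairs xy, represented by x < y *)
definition edges :: "nat \<Rightarrow> (nat \<times> nat) set" where
  "edges n = {(x, y). 1 \<le> x \<and> x < y \<and> y \<le> n}"

(* Matrices of operators on H_V in the basis |a>, a in configs: M b a = <b|M|a> *)
type_synonym mat = "(nat \<Rightarrow> real) \<Rightarrow> (nat \<Rightarrow> real) \<Rightarrow> real"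

definition transp_op :: "nat \<Rightarrow> nat \<Rightarrow> mat" where
  "transp_op x y = (\<lambda>b a. if b = a(x := a y, y := a x) then 1 else 0)"

definition id_op :: mat where
  "id_op = (\<lambda>b a. if b = a then 1 else 0)"

definition ham :: "real \<Rightarrow> nat \<Rightarrow> mat" where
  "ham S n = (\<lambda>b a. - (\<Sum>(x, y)\<in>edges n. transp_op x y b a - id_op b a))"

definition mat_mult :: "(nat \<Rightarrow> real) set \<Rightarrow> mat \<Rightarrow> mat \<Rightarrow> mat" where
  "mat_mult I A B = (\<lambda>i j. \<Sum>k\<in>I. A i k * B k j)"

primrec mat_pow :: "(nat \<Rightarrow> real) set \<Rightarrow> mat \<Rightarrow> nat \<Rightarrow> mat" where
  "mat_pow I A 0 = id_op"
| "mat_pow I A (Suc k) = mat_mult I A (mat_pow I A k)"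

definition mat_trace :: "(nat \<Rightarrow> real) set \<Rightarrow> mat \<Rightarrow> real" where
  "mat_trace I A = (\<Sum>i\<in>I. A i i)"

definition trace_exp :: "(nat \<Rightarrow> real) set \<Rightarrow> mat \<Rightarrow> real" where
  "trace_exp I A = (\<Sum>k. mat_trace I (mat_pow I A k) / fact k)"

definition partition_fn :: "real \<Rightarrow> real \<Rightarrow> nat \<Rightarrow> real" where
  "partition_fn S \<beta> n =
     trace_exp (configs S n) (\<lambda>b a. - (\<beta> / real n) * ham S n b a)"

definition Delta :: "nat \<Rightarrow> (nat \<Rightarrow> real) set" where
  "Delta \<theta> = {x. (\<forall>j\<in>{1..\<theta>}. 0 \<le> x j \<and> x j \<le> 1)
              \<and> (\<forall>i j. 1 \<le> i \<and> i \<le> j \<and> j \<le> \<theta> \<longrightarrow> x i \<ge> x j)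
              \<and> (\<Sum>j=1..\<theta>. x j) = 1}"

(* phi_beta, with 0 log 0 = 0 (holds for HOL's ln since ln 0 = 0) *)
definition phi :: "nat \<Rightarrow> real \<Rightarrow> (nat \<Rightarrow> real) \<Rightarrow> real" where
  "phi \<theta> \<beta> x = \<beta> / 2 * ((\<Sum>j=1..\<theta>. (x j)\<^sup>2) - 1)
                 - (\<Sum>j=1..\<theta>. if x j = 0 then 0 else x j * ln (x j))"

end

theory Submission
  imports Defs "HOL-Analysis.Analysis" "HOL-Library.Function_Algebras"
begin

text \<open>
  Let \<open>Q\<close> be the sum of all transpositions. On functions of configurations \<open>Q\<close> commutes with the
  matrix units \<open>E p q\<close> of \<open>gl(\<theta>)\<close> and is, up to a constant, the Casimir element
  \<open>(\<Sum>p q. E p q (E q p)) / 2\<close>. On the joint kernel of the raising operators \<open>E p q\<close>, \<open>p < q\<close>, it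
  therefore acts as multiplication by an explicit function of the occupation numbers of the
  configuration, which is at most half the sum of their squares. Each raising operator is nilpotent
  of order at most \<open>n + 1\<close>, so passing to its kernel costs at most a factor \<open>n + 1\<close> in dimension. Hence
  the trace of \<open>exp (\<beta> Q / n)\<close> is at most a polynomial in \<open>n\<close> times the partition function of the
  classical mean-field Potts model. Conversely, \<open>Q\<close> has nonnegative entries, so the trace is at least
  the sum of the exponentials of the diagonal entries, which is the same Potts partition function up
  to a bounded factor. The Potts model is solved by counting configurations with given occupation
  numbers (upper bound) and by Gibbs' inequality (lower bound).
\<close>

section \<open>Functions into a real vector space, with pointwise operations\<close>

instantiation "fun" :: (type, real_vector) real_vector
begin

definition scaleR_fun_def: "c *\<^sub>R f = (\<lambda>x. c *\<^sub>R f x)"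

instance
  by standard (simp_all add: scaleR_fun_def plus_fun_def scaleR_add_right scaleR_add_left)

end

lemma scaleR_fun_apply [simp]: "(c *\<^sub>R f) x = c *\<^sub>R f x"
  by (simp add: scaleR_fun_def)

lemma sum_fun_apply: "(\<Sum>i\<in>A. f i) x = (\<Sum>i\<in>A. f i x)"
  by (induction A rule: infinite_finite_induct) auto

section \<open>Linear algebra\<close>

text \<open>A maximal independent subset of V has at most as many elements as any finite spanning
  set. This moves a spanning set from outside V into V, so that preimages under an operator can be
  chosen for its elements.\<close>

lemma subspace_small_basis:
  fixes V :: "'v::real_vector set"
  assumes "V \<subseteq> span B" "finite B"
  obtains C where "C \<subseteq> V" "finite C" "card C \<le> card B" "V \<subseteq> span C"
proof -
  obtain C where C: "C \<subseteq> V" "independent C" "V \<subseteq> span C"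
    using maximal_independent_subset by blast
  with assms independent_span_bound[of B C] show thesis
    by (intro that[of C]) auto
qed

text \<open>Rank-nullity by induction on k: the image of V is killed by one power less, and its part
  of the kernel still lies in the span of B, so each step costs at most \<open>card B\<close>
  dimensions. Dimensions are measured by the sizes of finite spanning sets.\<close>

lemma nilpotent_span_bound:
  fixes E :: "'v::real_vector \<Rightarrow> 'v"
  assumes "linear E" "subspace V" "\<And>v. v \<in> V \<Longrightarrow> E v \<in> V" "\<And>v. v \<in> V \<Longrightarrow> (E ^^ k) v = 0"
    and "{v \<in> V. E v = 0} \<subseteq> span B" "finite B"
  shows "\<exists>B'. finite B' \<and> card B' \<le> k * card B \<and> V \<subseteq> span B'"
  using assms(2-5)
proof (induction k arbitrary: V)
  case 0
  then show ?case by (intro exI[of _ "{}"]) auto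
next
  case (Suc k)
  have "\<exists>B'. finite B' \<and> card B' \<le> k * card B \<and> E ` V \<subseteq> span B'"
  proof (rule Suc.IH)
    show "subspace (E ` V)" using assms(1) Suc.prems(1) by (rule linear_subspace_image)
    show "(E ^^ k) v = 0" if v: "v \<in> E ` V" for v
    proof -
      obtain w where "w \<in> V" "v = E w" using v by auto
      with Suc.prems(3)[of w] show ?thesis by (simp add: funpow_swap1)
    qed
  qed (use Suc.prems in auto)
  then obtain B' where "finite B'" and cB': "card B' \<le> k * card B" and "E ` V \<subseteq> span B'"
    by blast
  then obtain C where C: "C \<subseteq> E ` V" "finite C" "card C \<le> card B'" "E ` V \<subseteq> span C"
    using subspace_small_basis by metis
  \<comment> \<open>One preimage in V for each element of C. Together with the kernel these span V,
    because v has the same image as some d in the span of D.\<close>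
  then obtain D where D: "D \<subseteq> V" "finite D" "C = E ` D" "card D = card C"
    by (metis card_image finite_image_iff subset_image_inj)
  have "V \<subseteq> span (D \<union> B)"
  proof
    fix v assume v: "v \<in> V"
    have "E v \<in> E ` span D"
      using C(4) v D(3) linear_span_image[OF assms(1), of D] by auto
    then obtain d where d: "d \<in> span D" "E v = E d" by auto
    have "d \<in> V" using d(1) D(1) Suc.prems(1) span_minimal by blast
    then have "v - d \<in> {v \<in> V. E v = 0}"
      using v d(2) Suc.prems(1) assms(1) by (simp add: subspace_diff linear_diff)
    then have "v - d \<in> span (D \<union> B)"
      using Suc.prems(4) span_mono[of B "D \<union> B"] by auto
    moreover have "d \<in> span (D \<union> B)" using d(1) span_mono[of D "D \<union> B"] by auto
    ultimately have "v - d + d \<in> span (D \<union> B)" by (rule span_add)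
    then show "v \<in> span (D \<union> B)" by simp
  qed
  moreover have "card (D \<union> B) \<le> Suc k * card B"
    using card_Un_le[of D B] C(3) D(4) cB' by simp
  ultimately show ?case using D(2) assms(6) by blast
qed

text \<open>The product of the operators Q - c over the list, applied to v. A list with distinct
  entries gives a polynomial without multiple roots, which is what diagonalisation asks for.\<close>

primrec shift_prod :: "('v::real_vector \<Rightarrow> 'v) \<Rightarrow> real list \<Rightarrow> 'v \<Rightarrow> 'v" where
  "shift_prod Q [] v = v"
| "shift_prod Q (c # cs) v = shift_prod Q cs (Q v - c *\<^sub>R v)"

lemma shift_prod_zero: "linear Q \<Longrightarrow> shift_prod Q cs 0 = 0"
  by (induction cs) (simp_all add: linear_0)

lemma shift_prod_commute:
  assumes "linear L" "\<And>v. L (Q v) = Q (L v)"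
  shows "L (shift_prod Q cs v) = shift_prod Q cs (L v)"
  by (induction cs arbitrary: v) (simp_all add: assms linear_diff linear_scale)

lemma shift_prod_in:
  assumes "subspace V" "\<And>v. v \<in> V \<Longrightarrow> Q v \<in> V" "v \<in> V"
  shows "shift_prod Q cs v \<in> V"
  using assms(3)
  by (induction cs arbitrary: v) (simp_all add: assms(1,2) subspace_diff subspace_scale)

text \<open>Induction on the roots. The operator Q - c sends v into the span of eigenvectors for the
  remaining roots. On that span it is onto, because it multiplies an eigenvector for c' by c' - c,
  which is nonzero by distinctness. Subtracting a preimage from v leaves an element of the kernel of
  Q - c.\<close>

lemma in_span_eigenvectors:
  assumes "linear Q" "subspace F" "\<And>v. v \<in> F \<Longrightarrow> Q v \<in> F" "distinct cs"
    and "v \<in> F" "shift_prod Q cs v = 0"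
  shows "v \<in> span {g \<in> F. \<exists>c\<in>set cs. Q g = c *\<^sub>R g}"
  using assms(4-6)
proof (induction cs arbitrary: v)
  case Nil
  then show ?case by (simp add: span_zero)
next
  case (Cons c cs)
  let ?L = "\<lambda>v. Q v - c *\<^sub>R v"
  let ?G = "\<lambda>cs. {g \<in> F. \<exists>c\<in>set cs. Q g = c *\<^sub>R g}"
  have lin: "linear ?L"
    using assms(1) by (intro linear_compose_sub linear_compose_scale_right) (auto simp: linear_ident)
  have "?L v \<in> span (?G cs)"
    using Cons.prems by (intro Cons.IH) (auto simp: assms subspace_diff subspace_scale)
  moreover have "span (?G cs) \<subseteq> ?L ` span (?G cs)"
  proof (rule span_minimal)
    show "?G cs \<subseteq> ?L ` span (?G cs)"
    proof
      fix g assume g: "g \<in> ?G cs"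
      then obtain c' where c': "c' \<in> set cs" "Q g = c' *\<^sub>R g" by auto
      then have "c' \<noteq> c" using Cons.prems by auto
      then have "g = ?L ((1 / (c' - c)) *\<^sub>R g)"
        by (simp add: linear_scale[OF assms(1)] c'(2) flip: scaleR_diff_left diff_divide_distrib)
      moreover have "(1 / (c' - c)) *\<^sub>R g \<in> span (?G cs)"
        using g by (intro span_scale span_base)
      ultimately show "g \<in> ?L ` span (?G cs)" by (rule image_eqI)
    qed
  qed (use lin in \<open>simp add: linear_subspace_image\<close>)
  ultimately obtain u where u: "u \<in> span (?G cs)" "?L v = ?L u" by auto
  have "u \<in> F" using u(1) assms(2) span_minimal[of "?G cs" F] by auto
  then have "v - u \<in> ?G (c # cs)"
    using u(2) Cons.prems(2) assms(1,2) by (simp add: subspace_diff linear_diff algebra_simps)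
  then have "v - u \<in> span (?G (c # cs))" by (rule span_base)
  moreover have "u \<in> span (?G (c # cs))" using u(1) span_mono[of "?G cs" "?G (c # cs)"] by auto
  ultimately have "v - u + u \<in> span (?G (c # cs))" by (rule span_add)
  then show ?case by simp
qed

text \<open>Removing from an upward closed set an element of minimal height leaves an upward closed
  set, so the operators can be treated one at a time.\<close>

lemma joint_kernel_induct:
  fixes E :: "'r \<Rightarrow> 'v::real_vector \<Rightarrow> 'v" and ht :: "'r \<Rightarrow> real"
  assumes fin: "finite R"
    and F: "\<And>r v. r \<in> R \<Longrightarrow> v \<in> F \<Longrightarrow> E r v \<in> F"
    and comm: "\<And>r s v. \<lbrakk>r \<in> R; s \<in> R; v \<in> F; E r v = 0;
                  \<And>t. t \<in> R \<Longrightarrow> ht t > ht s \<Longrightarrow> E t v = 0\<rbrakk> \<Longrightarrow> E r (E s v) = 0"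
    and step: "\<And>j s A. \<lbrakk>s \<in> R; A \<subseteq> R; \<And>v. v \<in> F \<Longrightarrow> (\<forall>r\<in>A. E r v = 0) \<Longrightarrow> (\<forall>r\<in>A. E r (E s v) = 0);
                  P j {v \<in> F. \<forall>r\<in>insert s A. E r v = 0}\<rbrakk> \<Longrightarrow> P (Suc j) {v \<in> F. \<forall>r\<in>A. E r v = 0}"
    and base: "P 0 {v \<in> F. \<forall>r\<in>R. E r v = 0}"
  shows "P (card R) F"
proof -
  \<comment> \<open>Generalised to every upward closed A: the number j counts the operators already
    dropped from R, so it is 0 at A = R.\<close>
  have "P (j + card A) F"
    if "A \<subseteq> R" "\<And>r t. r \<in> A \<Longrightarrow> t \<in> R \<Longrightarrow> ht t > ht r \<Longrightarrow> t \<in> A"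
      "P j {v \<in> F. \<forall>r\<in>A. E r v = 0}" for A j
    using that
  proof (induction "card A" arbitrary: A j)
    case 0
    then have "A = {}" using fin finite_subset by fastforce
    with 0 show ?case by simp
  next
    case (Suc k)
    have finA: "finite A" using Suc.prems(1) fin finite_subset by blast
    have "A \<noteq> {}" using Suc.hyps(2) by auto
    then obtain s where s: "s \<in> A" "\<And>r. r \<in> A \<Longrightarrow> ht s \<le> ht r"
      using ex_min_if_finite[of "ht ` A"] finA by (auto simp: not_less)
    let ?A = "A - {s}"
    have A: "insert s ?A = A" using s(1) by auto
    have "P (Suc j) {v \<in> F. \<forall>r\<in>?A. E r v = 0}"
    proof (rule step)
      \<comment> \<open>An operator higher than s lies in A by upward closure and differs from s,
        hence kills v; this is the last premise of \<open>comm\<close>.\<close>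
      show "\<forall>r\<in>?A. E r (E s v) = 0" if "v \<in> F" "\<forall>r\<in>?A. E r v = 0" for v
        using that s Suc.prems(1,2) by (auto intro!: comm)
      show "P j {v \<in> F. \<forall>r\<in>insert s ?A. E r v = 0}" using Suc.prems(3) A by simp
    qed (use s(1) Suc.prems(1) in auto)
    then have "P (Suc j + card ?A) F"
      using Suc.hyps(2) s Suc.prems(1,2) finA
      by (intro Suc.hyps(1)) (auto dest: leD)
    then show ?case using Suc.hyps(2) s(1) finA by simp
  qed
  from this[of R 0] base show ?thesis by simp
qed

section \<open>Traces in an eigenbasis\<close>

text \<open>The coefficient functions of vectors in the span of the basis indexed by I, as a
  subspace of all functions; \<open>point a\<close> is the basis vector belonging to a.\<close>

definition supported :: "'c set \<Rightarrow> ('c \<Rightarrow> real) set" where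
  "supported I = {f. \<forall>a. a \<notin> I \<longrightarrow> f a = 0}"

definition point :: "'c \<Rightarrow> 'c \<Rightarrow> real" where
  "point a = (\<lambda>b. if b = a then 1 else 0)"

lemma subspace_supported: "subspace (supported I)"
  by (auto simp: subspace_def supported_def)

lemma supported_expand:
  assumes "finite I" "f \<in> supported I"
  shows "f = (\<Sum>a\<in>I. f a *\<^sub>R point a)"
proof
  fix b
  have "(\<Sum>a\<in>I. f a *\<^sub>R point a) b = (\<Sum>a\<in>I. if a = b then f a else 0)"
    by (auto simp: sum_fun_apply point_def intro!: sum.cong)
  also have "\<dots> = f b" using assms by (auto simp: supported_def)
  finally show "f b = (\<Sum>a\<in>I. f a *\<^sub>R point a) b" ..
qed

lemma supported_span:
  assumes "finite I"
  shows "supported I \<subseteq> span (point ` I)"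
proof
  fix f assume "f \<in> supported I"
  then show "f \<in> span (point ` I)"
    by (subst supported_expand[OF assms]) (auto intro!: span_sum span_scale intro: span_base)
qed

lemma finite_independent_supported:
  assumes "finite I" "independent B" "B \<subseteq> supported I"
  shows "finite B"
  using independent_span_bound[of "point ` I" B] assms supported_span[of I] by auto

text \<open>Basis invariance of the trace: expand each \<open>point a\<close> in B, apply M
  termwise, then exchange the sums. As B is an arbitrary basis of eigenvectors, its coordinates are
  taken from \<open>representation\<close>.\<close>

lemma mat_trace_eigenbasis:
  assumes I: "finite I" and B: "independent B" "B \<subseteq> supported I" "supported I \<subseteq> span B"
    and eig: "\<And>b a. b \<in> B \<Longrightarrow> a \<in> I \<Longrightarrow> (\<Sum>c\<in>I. M a c * b c) = ev b * b a"
  shows "mat_trace I M = (\<Sum>b\<in>B. ev b)"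
proof -
  let ?r = "\<lambda>a b. representation B (point a) b"
  have finB: "finite B" using finite_independent_supported I B by blast
  have pt: "point a \<in> span B" if "a \<in> I" for a
    using B(3) that by (auto simp: supported_def point_def)
  have "M a a = (\<Sum>b\<in>B. ?r a b * (ev b * b a))" if a: "a \<in> I" for a
  proof -
    have "point a c = (\<Sum>b\<in>B. ?r a b * b c)" for c
    proof -
      have "point a = (\<Sum>b\<in>B. ?r a b *\<^sub>R b)"
        using sum_representation_eq[OF B(1) pt[OF a] finB] by simp
      then have "point a c = (\<Sum>b\<in>B. ?r a b *\<^sub>R b) c" by (rule fun_cong)
      then show ?thesis by (simp add: sum_fun_apply)
    qed
    then have "(\<Sum>c\<in>I. M a c * point a c) = (\<Sum>c\<in>I. \<Sum>b\<in>B. ?r a b * (M a c * b c))"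
      by (simp add: sum_distrib_left mult_ac)
    also have "\<dots> = (\<Sum>b\<in>B. \<Sum>c\<in>I. ?r a b * (M a c * b c))" by (rule sum.swap)
    also have "\<dots> = (\<Sum>b\<in>B. ?r a b * (ev b * b a))"
      using a by (simp add: eig flip: sum_distrib_left)
    also have "(\<Sum>c\<in>I. M a c * point a c) = M a a"
      using I a by (simp add: point_def if_distrib cong: if_cong)
    finally show ?thesis .
  qed
  then have "mat_trace I M = (\<Sum>a\<in>I. \<Sum>b\<in>B. ?r a b * (ev b * b a))"
    by (simp add: mat_trace_def)
  also have "\<dots> = (\<Sum>b\<in>B. \<Sum>a\<in>I. ?r a b * (ev b * b a))" by (rule sum.swap)
  also have "\<dots> = (\<Sum>b\<in>B. ev b)"
  proof (rule sum.cong)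
    fix b assume b: "b \<in> B"
    \<comment> \<open>Expanding b in point masses and reading off its own coordinate, which is 1,
      shows that the two changes of basis are inverse to each other on the diagonal.\<close>
    have "representation B b b = representation B (\<Sum>a\<in>I. b a *\<^sub>R point a) b"
      using supported_expand[OF I, of b] b B(2) by auto
    also have "\<dots> = (\<Sum>a\<in>I. b a * ?r a b)"
      using B(1) pt by (simp add: representation_sum representation_scale span_scale)
    finally have "(\<Sum>a\<in>I. b a * ?r a b) = 1"
      using B(1) b by (simp add: representation_basis)
    moreover have "(\<Sum>a\<in>I. ?r a b * (ev b * b a)) = ev b * (\<Sum>a\<in>I. b a * ?r a b)"
      by (simp add: sum_distrib_left mult_ac)
    ultimately show "(\<Sum>a\<in>I. ?r a b * (ev b * b a)) = ev b" by simp
  qed simp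
  finally show ?thesis .
qed

lemma mat_pow_eigenvector:
  assumes I: "finite I" and f: "\<And>a. a \<in> I \<Longrightarrow> (\<Sum>c\<in>I. A a c * f c) = q * f a" and a: "a \<in> I"
  shows "(\<Sum>c\<in>I. mat_pow I A k a c * f c) = q ^ k * f a"
  using a
proof (induction k arbitrary: a)
  case 0
  have "(\<Sum>c\<in>I. mat_pow I A 0 a c * f c) = (\<Sum>c\<in>I. if c = a then f c else 0)"
    by (auto simp: id_op_def intro!: sum.cong)
  then show ?case using 0 I by simp
next
  case (Suc k)
  have "(\<Sum>c\<in>I. mat_pow I A (Suc k) a c * f c) = (\<Sum>c\<in>I. \<Sum>d\<in>I. A a d * (mat_pow I A k d c * f c))"
    by (simp add: mat_mult_def sum_distrib_left sum_distrib_right mult_ac)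
  also have "\<dots> = (\<Sum>d\<in>I. \<Sum>c\<in>I. A a d * (mat_pow I A k d c * f c))" by (rule sum.swap)
  also have "\<dots> = (\<Sum>d\<in>I. A a d * (q ^ k * f d))"
    by (simp add: Suc.IH flip: sum_distrib_left)
  also have "\<dots> = q ^ k * (\<Sum>d\<in>I. A a d * f d)" by (simp add: sum_distrib_left mult_ac)
  finally show ?case using f Suc.prems by simp
qed

text \<open>The trace of the k-th power is the k-th power sum of the eigenvalues. The form with
  \<open>sums\<close> also records convergence, which the comparison with the diagonal entries
  uses.\<close>

lemma trace_exp_eigenbasis_sums:
  assumes I: "finite I" and B: "independent B" "B \<subseteq> supported I" "supported I \<subseteq> span B"
    and eig: "\<And>b a. b \<in> B \<Longrightarrow> a \<in> I \<Longrightarrow> (\<Sum>c\<in>I. A a c * b c) = ev b * b a"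
  shows "(\<lambda>k. mat_trace I (mat_pow I A k) / fact k) sums (\<Sum>b\<in>B. exp (ev b))"
proof -
  have "mat_trace I (mat_pow I A k) = (\<Sum>b\<in>B. ev b ^ k)" for k
    using I B by (rule mat_trace_eigenbasis) (rule mat_pow_eigenvector[OF I eig])
  then have "mat_trace I (mat_pow I A k) / fact k = (\<Sum>b\<in>B. ev b ^ k /\<^sub>R fact k)" for k
    by (simp add: sum_distrib_left divide_inverse mult.commute)
  then show ?thesis by (simp only:) (intro sums_sum exp_converges)
qed

lemma trace_exp_eigenbasis:
  assumes "finite I" "independent B" "B \<subseteq> supported I" "supported I \<subseteq> span B"
    and "\<And>b a. b \<in> B \<Longrightarrow> a \<in> I \<Longrightarrow> (\<Sum>c\<in>I. A a c * b c) = ev b * b a"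
  shows "trace_exp I A = (\<Sum>b\<in>B. exp (ev b))"
  unfolding trace_exp_def using trace_exp_eigenbasis_sums[OF assms] by (simp add: sums_iff)

lemma mat_pow_nonneg:
  assumes "\<And>a c. 0 \<le> A a c"
  shows "0 \<le> mat_pow I A k a c"
  by (induction k arbitrary: a) (auto simp: id_op_def mat_mult_def intro!: sum_nonneg mult_nonneg_nonneg assms)

text \<open>Among the closed walks of length k at a, only the one that stays at a is kept; all
  others have nonnegative weight.\<close>

lemma mat_pow_diag_ge:
  assumes "finite I" "\<And>a c. 0 \<le> A a c" "a \<in> I"
  shows "A a a ^ k \<le> mat_pow I A k a a"
proof (induction k)
  case (Suc k)
  have "A a a ^ Suc k \<le> A a a * mat_pow I A k a a"
    using Suc assms(2) by (simp add: mult_left_mono)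
  also have "\<dots> \<le> (\<Sum>c\<in>I. A a c * mat_pow I A k c a)"
    using assms by (intro member_le_sum) (auto intro!: mult_nonneg_nonneg mat_pow_nonneg)
  finally show ?case by (simp add: mat_mult_def)
qed (simp add: id_op_def)

lemma sum_exp_diag_le:
  assumes I: "finite I" and A: "\<And>a c. 0 \<le> A a c"
    and s: "(\<lambda>k. mat_trace I (mat_pow I A k) / fact k) sums s"
  shows "(\<Sum>a\<in>I. exp (A a a)) \<le> s"
proof (rule sums_le[OF _ _ s])
  show "(\<lambda>k. \<Sum>a\<in>I. A a a ^ k /\<^sub>R fact k) sums (\<Sum>a\<in>I. exp (A a a))"
    by (intro sums_sum exp_converges)
  show "(\<Sum>a\<in>I. A a a ^ k /\<^sub>R fact k) \<le> mat_trace I (mat_pow I A k) / fact k" for k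
    unfolding mat_trace_def sum_divide_distrib
    by (intro sum_mono) (use mat_pow_diag_ge[OF I, of A] A in \<open>simp add: divide_simps mult_ac\<close>)
qed

section \<open>Matrix units acting on the tensor power\<close>

text \<open>The matrix unit |p><q| summed over the sites, written on coefficient functions: the
  action of gl(\<theta>) on the tensor power.\<close>

definition unit_op :: "nat \<Rightarrow> 's \<Rightarrow> 's \<Rightarrow> ((nat \<Rightarrow> 's) \<Rightarrow> real) \<Rightarrow> (nat \<Rightarrow> 's) \<Rightarrow> real" where
  "unit_op n p q f = (\<lambda>a. \<Sum>x=1..n. if a x = p then f (a(x := q)) else 0)"

definition swap_sum :: "nat \<Rightarrow> ((nat \<Rightarrow> 's) \<Rightarrow> real) \<Rightarrow> (nat \<Rightarrow> 's) \<Rightarrow> real" where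
  "swap_sum n f = (\<lambda>a. \<Sum>(x, y)\<in>edges n. f (a(x := a y, y := a x)))"

definition occ :: "nat \<Rightarrow> (nat \<Rightarrow> 's) \<Rightarrow> 's \<Rightarrow> nat" where
  "occ n a p = card {x \<in> {1..n}. a x = p}"

lemma finite_edges: "finite (edges n)"
  by (rule finite_subset[of _ "{1..n} \<times> {1..n}"]) (auto simp: edges_def)

lemma occ_eq_sum: "real (occ n a p) = (\<Sum>x=1..n. if a x = p then 1 else 0)"
  by (simp add: occ_def sum.If_cases Int_def conj_commute)

lemma occ_le: "occ n a p \<le> n"
proof -
  have "card {x \<in> {1..n}. a x = p} \<le> card {1..n}" by (rule card_mono) auto
  then show ?thesis by (simp add: occ_def)
qed

lemma sum_over_sites:
  assumes "finite P" "a \<in> PiE {1..n} (\<lambda>_. P)"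
  shows "(\<Sum>x=1..n. g (a x)) = (\<Sum>p\<in>P. real (occ n a p) * (g p :: real))"
proof -
  have "(\<Sum>x=1..n. g (a x)) = (\<Sum>x=1..n. \<Sum>p\<in>P. if a x = p then g p else 0)"
    using assms by (intro sum.cong) (auto simp: PiE_mem)
  also have "\<dots> = (\<Sum>p\<in>P. \<Sum>x=1..n. if a x = p then g p else 0)" by (rule sum.swap)
  also have "\<dots> = (\<Sum>p\<in>P. real (occ n a p) * g p)"
    unfolding occ_eq_sum sum_distrib_right by (intro sum.cong) auto
  finally show ?thesis .
qed

lemma sum_occ:
  assumes "finite P" "a \<in> PiE {1..n} (\<lambda>_. P)"
  shows "(\<Sum>p\<in>P. real (occ n a p)) = real n"
  using sum_over_sites[OF assms, of "\<lambda>_. 1"] by simp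

lemma sum_pairs_edges:
  fixes g :: "nat \<Rightarrow> nat \<Rightarrow> real"
  assumes "\<And>x y. g x y = g y x"
  shows "(\<Sum>x=1..n. \<Sum>y\<in>{1..n}-{x}. g x y) = 2 * (\<Sum>(x, y)\<in>edges n. g x y)"
proof -
  let ?E = "edges n" and ?E' = "prod.swap ` edges n"
  have "(\<Sum>x=1..n. \<Sum>y\<in>{1..n}-{x}. g x y) = (\<Sum>(x, y)\<in>(SIGMA x:{1..n}. {1..n}-{x}). g x y)"
    by (rule sum.Sigma) auto
  also have "(SIGMA x:{1..n}. {1..n}-{x}) = ?E \<union> ?E'"
    by (force simp: edges_def image_iff)
  also have "(\<Sum>(x, y)\<in>?E \<union> ?E'. g x y) = (\<Sum>(x, y)\<in>?E. g x y) + (\<Sum>(x, y)\<in>?E'. g x y)"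
    by (rule sum.union_disjoint) (auto simp: finite_edges, auto simp: edges_def)
  also have "(\<Sum>(x, y)\<in>?E'. g x y) = (\<Sum>(x, y)\<in>?E. g x y)"
    by (subst sum.reindex) (auto simp: assms intro!: sum.cong)
  finally show ?thesis by simp
qed

lemma sum_pairs_swap:
  fixes g :: "'a \<Rightarrow> 'a \<Rightarrow> real"
  assumes "finite A"
  shows "(\<Sum>x\<in>A. \<Sum>y\<in>A-{x}. g x y) = (\<Sum>x\<in>A. \<Sum>y\<in>A-{x}. g y x)"
proof -
  have e: "(\<Sum>x\<in>A. \<Sum>y\<in>A-{x}. g x y) = (\<Sum>x\<in>A. \<Sum>y\<in>A. if x = y then 0 else g x y)"
    for g :: "'a \<Rightarrow> 'a \<Rightarrow> real"
    using assms by (intro sum.cong refl sum.mono_neutral_cong_left) auto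
  show ?thesis unfolding e by (subst sum.swap) (auto intro!: sum.cong)
qed

lemma card_edges: "2 * real (card (edges n)) = real n * (real n - 1)"
proof -
  have "(\<Sum>x=1..n. \<Sum>y\<in>{1..n}-{x}. 1) = 2 * (\<Sum>(x, y)\<in>edges n. 1::real)"
    by (rule sum_pairs_edges) simp
  moreover have "(\<Sum>x=1..n. \<Sum>y\<in>{1..n}-{x}. 1::real) = (\<Sum>x=1..n. real n - 1)"
    by (intro sum.cong) auto
  ultimately show ?thesis by (simp add: case_prod_unfold)
qed

lemma linear_unit_op: "linear (unit_op n p q)"
  by (rule linearI) (auto simp: unit_op_def fun_eq_iff sum_distrib_left if_distrib
      simp flip: sum.distrib intro!: sum.cong)

lemma linear_swap_sum: "linear (swap_sum n)"
  by (rule linearI) (auto simp: swap_sum_def fun_eq_iff sum_distrib_left case_prod_unfold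
      simp flip: sum.distrib)

lemma unit_op_supported:
  assumes "f \<in> supported (PiE {1..n} (\<lambda>_. P))" "p \<in> P"
  shows "unit_op n p q f \<in> supported (PiE {1..n} (\<lambda>_. P))"
proof -
  have "f (a(x := q)) = 0" if "a \<notin> PiE {1..n} (\<lambda>_. P)" "x \<in> {1..n}" "a x = p" for a x
  proof -
    have "a(x := q) \<notin> PiE {1..n} (\<lambda>_. P)"
    proof
      assume m: "a(x := q) \<in> PiE {1..n} (\<lambda>_. P)"
      have "a y \<in> P" if "y \<in> {1..n}" for y
        using PiE_mem[OF m that] \<open>a x = p\<close> assms(2) by (cases "y = x") auto
      moreover have "a y = undefined" if "y \<notin> {1..n}" for y
        using PiE_arb[OF m that] that \<open>x \<in> {1..n}\<close> by (auto split: if_splits)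
      ultimately show False using that(1) by (auto simp: PiE_def extensional_def)
    qed
    then show ?thesis using assms(1) by (auto simp: supported_def)
  qed
  then show ?thesis unfolding supported_def unit_op_def
    by (intro CollectI allI impI sum.neutral ballI) simp
qed

lemma swap_swap:
  "(a(x := a y, y := a x))(x := (a(x := a y, y := a x)) y, y := (a(x := a y, y := a x)) x) = a"
  by (auto simp: fun_eq_iff)

lemma swap_in_PiE_iff:
  assumes "x \<in> {1..n}" "y \<in> {1..n}"
  shows "a(x := a y, y := a x) \<in> PiE {1..n} (\<lambda>_. P) \<longleftrightarrow> a \<in> PiE {1..n} (\<lambda>_. P)"
proof -
  have imp: "b(x := b y, y := b x) \<in> PiE {1..n} (\<lambda>_. P)" if "b \<in> PiE {1..n} (\<lambda>_. P)" for b
    using that assms by (auto simp: PiE_iff extensional_def)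
  show ?thesis using imp[of a] imp[of "a(x := a y, y := a x)"] by (metis swap_swap)
qed

lemma edges_mem: "(x, y) \<in> edges n \<Longrightarrow> x \<in> {1..n} \<and> y \<in> {1..n} \<and> x \<noteq> y"
  by (auto simp: edges_def)

lemma swap_sum_supported:
  assumes "f \<in> supported (PiE {1..n} (\<lambda>_. P))"
  shows "swap_sum n f \<in> supported (PiE {1..n} (\<lambda>_. P))"
  unfolding supported_def swap_sum_def
proof (intro CollectI allI impI sum.neutral ballI)
  fix a e assume a: "a \<notin> PiE {1..n} (\<lambda>_. P)" and "e \<in> edges n"
  then obtain x y where e: "e = (x, y)" "x \<in> {1..n}" "y \<in> {1..n}" by (cases e) (auto dest: edges_mem)
  then have "a(x := a y, y := a x) \<notin> PiE {1..n} (\<lambda>_. P)" using a by (simp only: swap_in_PiE_iff) simp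
  then show "(case e of (x, y) \<Rightarrow> f (a(x := a y, y := a x))) = 0"
    using assms unfolding supported_def e(1) by simp
qed

lemma unit_op_swap:
  assumes "x \<in> {1..n}" "y \<in> {1..n}"
  shows "unit_op n p q (\<lambda>a. f (a(x := a y, y := a x))) a = unit_op n p q f (a(x := a y, y := a x))"
proof -
  let ?t = "\<lambda>z. if z = x then y else if z = y then x else z"
  have "bij_betw ?t {1..n} {1..n}"
    by (rule bij_betw_byWitness[where f' = ?t]) (use assms in auto)
  then have "unit_op n p q f (a(x := a y, y := a x)) = (\<Sum>z=1..n.
      if (a(x := a y, y := a x)) (?t z) = p then f ((a(x := a y, y := a x))(?t z := q)) else 0)"
    unfolding unit_op_def by (rule sum.reindex_bij_betw[symmetric])
  also have "\<dots> = unit_op n p q (\<lambda>a. f (a(x := a y, y := a x))) a"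
    unfolding unit_op_def
  proof (rule sum.cong)
    fix z
    have "(a(x := a y, y := a x))(?t z := q) = (a(z := q))(x := (a(z := q)) y, y := (a(z := q)) x)"
      by (auto simp: fun_eq_iff)
    then show "(if (a(x := a y, y := a x)) (?t z) = p then f ((a(x := a y, y := a x))(?t z := q)) else 0)
      = (if a z = p then f ((a(z := q))(x := (a(z := q)) y, y := (a(z := q)) x)) else 0)"
      by simp
  qed simp
  finally show ?thesis ..
qed

text \<open>A matrix unit acts on all sites alike, so it commutes with every permutation of the
  sites; for one transposition (\<open>unit_op_swap\<close>) this is a reindexing of the sum over
  sites.\<close>

lemma unit_op_swap_sum: "unit_op n p q (swap_sum n f) = swap_sum n (unit_op n p q f)"
proof
  fix a
  have s: "swap_sum n f = (\<Sum>e\<in>edges n. (\<lambda>a. f (a(fst e := a (snd e), snd e := a (fst e)))))" for f :: "(nat \<Rightarrow> 'a) \<Rightarrow> real"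
    by (simp add: swap_sum_def fun_eq_iff sum_fun_apply case_prod_unfold)
  show "unit_op n p q (swap_sum n f) a = swap_sum n (unit_op n p q f) a"
    unfolding s[of f] linear_sum[OF linear_unit_op]
    by (auto simp: sum_fun_apply swap_sum_def case_prod_unfold unit_op_swap dest!: edges_mem intro!: sum.cong)
qed

text \<open>Sorts the double sum by whether the two operators hit the same site, where matrix units
  multiply, or two distinct sites, where they act independently.\<close>

lemma unit_op_unit_op:
  "unit_op n p q (unit_op n r s f) a = (if q = r then unit_op n p s f a else 0)
     + (\<Sum>x=1..n. \<Sum>y\<in>{1..n}-{x}. if a x = p \<and> a y = r then f (a(x := q, y := s)) else 0)"
proof -
  have "unit_op n p q (unit_op n r s f) a =
    (\<Sum>x=1..n. (if a x = p \<and> q = r then f (a(x := s)) else 0)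
      + (\<Sum>y\<in>{1..n}-{x}. if a x = p \<and> a y = r then f (a(x := q, y := s)) else 0))"
    unfolding unit_op_def
  proof (rule sum.cong)
    fix x assume x: "x \<in> {1..n}"
    show "(if a x = p then \<Sum>y=1..n. if (a(x := q)) y = r then f (a(x := q, y := s)) else 0 else 0)
      = (if a x = p \<and> q = r then f (a(x := s)) else 0)
      + (\<Sum>y\<in>{1..n}-{x}. if a x = p \<and> a y = r then f (a(x := q, y := s)) else 0)"
      using x by (subst sum.remove[of _ x]) (auto intro!: sum.cong)
  qed simp
  then show ?thesis by (auto simp: sum.distrib unit_op_def intro!: sum.cong)
qed

text \<open>The commutation relation of gl(\<theta>). The two-site parts of both orders agree, since
  updates at distinct sites commute and the two sites can be renamed; only the same-site parts
  remain.\<close>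

lemma unit_op_commutator:
  "unit_op n p q (unit_op n r s f) a = unit_op n r s (unit_op n p q f) a
     + (if q = r then unit_op n p s f a else 0) - (if s = p then unit_op n r q f a else 0)"
proof -
  have "(\<Sum>x=1..n. \<Sum>y\<in>{1..n}-{x}. if a x = p \<and> a y = r then f (a(x := q, y := s)) else 0)
      = (\<Sum>x=1..n. \<Sum>y\<in>{1..n}-{x}. if a y = p \<and> a x = r then f (a(y := q, x := s)) else 0)"
    by (rule sum_pairs_swap) simp
  also have "\<dots> = (\<Sum>x=1..n. \<Sum>y\<in>{1..n}-{x}. if a x = r \<and> a y = p then f (a(x := s, y := q)) else 0)"
    by (intro sum.cong refl) (metis DiffD2 fun_upd_twist singletonI)
  finally show ?thesis by (simp add: unit_op_unit_op)
qed

lemma unit_op_diag: "unit_op n p p f a = real (occ n a p) * f a"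
  unfolding occ_eq_sum unit_op_def sum_distrib_right by (auto intro!: sum.cong)

text \<open>In the value at a, each application turns one site with value p into q, so k
  applications vanish once p occurs fewer than k times; it occurs at most n times.\<close>

lemma unit_op_nilpotent:
  assumes "p \<noteq> q"
  shows "(unit_op n p q ^^ Suc n) f = 0"
proof -
  have "(unit_op n p q ^^ k) f a = 0" if "occ n a p < k" for k a
    using that
  proof (induction k arbitrary: a)
    case (Suc k)
    have "(unit_op n p q ^^ k) f (a(x := q)) = 0" if "x \<in> {1..n}" "a x = p" for x
    proof -
      have "{y \<in> {1..n}. (a(x := q)) y = p} \<subset> {y \<in> {1..n}. a y = p}"
        using that assms by auto
      then have "occ n (a(x := q)) p < occ n a p"
        unfolding occ_def by (intro psubset_card_mono) auto
      then show ?thesis using Suc.prems by (intro Suc.IH) linarith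
    qed
    then show ?case by (auto simp: unit_op_def[of n p q "(unit_op n p q ^^ k) f"] intro!: sum.neutral)
  qed simp
  then show ?thesis using occ_le[of n _ p] by (auto simp: fun_eq_iff le_imp_less_Suc simp del: funpow.simps)
qed

text \<open>The two-site part exchanges the values of two sites, and each edge occurs as two ordered
  pairs. The same-site part is a sum of diagonal matrix units, whose eigenvalues are the occupation
  numbers with total n.\<close>

lemma casimir:
  assumes "finite P" "a \<in> PiE {1..n} (\<lambda>_. P)"
  shows "(\<Sum>p\<in>P. \<Sum>q\<in>P. unit_op n p q (unit_op n q p f) a) = 2 * swap_sum n f a + real (card P) * real n * f a"
proof -
  have "(\<Sum>p\<in>P. \<Sum>q\<in>P. unit_op n p q (unit_op n q p f) a) = (\<Sum>p\<in>P. \<Sum>q\<in>P. unit_op n p p f a)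
    + (\<Sum>p\<in>P. \<Sum>q\<in>P. \<Sum>x=1..n. \<Sum>y\<in>{1..n}-{x}. if a x = p \<and> a y = q then f (a(x := q, y := p)) else 0)"
    by (simp add: unit_op_unit_op sum.distrib)
  also have "(\<Sum>p\<in>P. \<Sum>q\<in>P. unit_op n p p f a) = real (card P) * real n * f a"
    using sum_occ[OF assms] by (simp add: unit_op_diag flip: sum_distrib_left sum_distrib_right)
  also have "(\<Sum>p\<in>P. \<Sum>q\<in>P. \<Sum>x=1..n. \<Sum>y\<in>{1..n}-{x}. if a x = p \<and> a y = q then f (a(x := q, y := p)) else 0)
    = (\<Sum>x=1..n. \<Sum>p\<in>P. \<Sum>q\<in>P. \<Sum>y\<in>{1..n}-{x}. if a x = p \<and> a y = q then f (a(x := q, y := p)) else 0)"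
    by (subst sum.swap, subst sum.swap[of _ "{1..n}"]) (auto intro!: sum.cong sum.swap)
  also have "\<dots> = (\<Sum>x=1..n. \<Sum>y\<in>{1..n}-{x}. \<Sum>p\<in>P. \<Sum>q\<in>P. if a x = p \<and> a y = q then f (a(x := q, y := p)) else 0)"
    by (intro sum.cong refl, subst sum.swap, subst sum.swap[of _ "{1..n}-{_}"]) (auto intro!: sum.cong sum.swap)
  also have "\<dots> = (\<Sum>x=1..n. \<Sum>y\<in>{1..n}-{x}. f (a(x := a y, y := a x)))"
  proof (intro sum.cong refl)
    fix x y assume "x \<in> {1..n}" "y \<in> {1..n}-{x}"
    then have P: "a x \<in> P" "a y \<in> P" using assms(2) by (auto simp: PiE_mem)
    have "(\<Sum>p\<in>P. \<Sum>q\<in>P. if a x = p \<and> a y = q then f (a(x := q, y := p)) else 0)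
      = (\<Sum>p\<in>P. if p = a x then (\<Sum>q\<in>P. if q = a y then f (a(x := q, y := p)) else 0) else 0)"
      by (auto intro!: sum.cong)
    then show "(\<Sum>p\<in>P. \<Sum>q\<in>P. if a x = p \<and> a y = q then f (a(x := q, y := p)) else 0) = f (a(x := a y, y := a x))"
      using P assms(1) by simp
  qed
  also have "\<dots> = 2 * swap_sum n f a"
    unfolding swap_sum_def
    by (rule sum_pairs_edges) (metis fun_upd_idem fun_upd_twist)
  finally show ?thesis by simp
qed

section \<open>Highest weights and the Casimir value\<close>

definition pos_roots :: "real set \<Rightarrow> (real \<times> real) set" where
  "pos_roots P = {(p, q) \<in> P \<times> P. p < q}"

text \<open>With the occupation numbers m as weight, the double sum is the Casimir value (m, m + 2
  rho) of gl(\<theta>). Removing the same-site term of \<open>casimir\<close> and halving gives the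
  value of \<open>swap_sum\<close>.\<close>

definition casimir_val :: "real set \<Rightarrow> nat \<Rightarrow> (nat \<Rightarrow> real) \<Rightarrow> real" where
  "casimir_val P n a = ((\<Sum>p\<in>P. \<Sum>q\<in>P. if p = q then (real (occ n a p))\<^sup>2
      else if p < q then real (occ n a p) - real (occ n a q) else 0) - real (card P) * real n) / 2"

lemma finite_pos_roots: "finite P \<Longrightarrow> finite (pos_roots P)"
  by (rule finite_subset[of _ "P \<times> P"]) (auto simp: pos_roots_def)

lemma unit_op_zero [simp]: "unit_op n p q 0 = 0"
  by (rule linear_0[OF linear_unit_op])

text \<open>The commutator is zero or, up to sign, the raising operator for (p, q') or (p', q). The
  gap of that pair is larger than q' - p', so the operator kills v by \<open>high\<close>.\<close>

lemma unit_op_pos_roots_commute: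
  assumes r: "(p, q) \<in> pos_roots P" and s: "(p', q') \<in> pos_roots P"
    and rv: "unit_op n p q v = 0"
    and high: "\<And>t. t \<in> pos_roots P \<Longrightarrow> snd t - fst t > q' - p' \<Longrightarrow> unit_op n (fst t) (snd t) v = 0"
  shows "unit_op n p q (unit_op n p' q' v) = 0"
proof
  fix a
  have 1: "unit_op n p q' v = 0" if "q = p'"
    using high[of "(p, q')"] r s that by (auto simp: pos_roots_def)
  have 2: "unit_op n p' q v = 0" if "q' = p"
    using high[of "(p', q)"] r s that by (auto simp: pos_roots_def)
  show "unit_op n p q (unit_op n p' q' v) a = 0 a"
    using 1 2 by (subst unit_op_commutator) (auto simp: rv)
qed

text \<open>On a vector killed by all raising operators the Casimir element reduces to its Cartan part,
  which acts on every configuration by a scalar.\<close>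

lemma swap_sum_highest_weight:
  assumes P: "finite P" and v: "v \<in> supported (PiE {1..n} (\<lambda>_. P))"
    and hw: "\<And>r. r \<in> pos_roots P \<Longrightarrow> unit_op n (fst r) (snd r) v = 0"
  shows "swap_sum n v a = casimir_val P n a * v a"
proof (cases "a \<in> PiE {1..n} (\<lambda>_. P)")
  case False
  then show ?thesis
    using v swap_sum_supported[OF v] by (simp only: supported_def mem_Collect_eq) simp
next
  case True
  have hw': "unit_op n p q v = 0" if "p \<in> P" "q \<in> P" "p < q" for p q
    using hw[of "(p, q)"] that by (simp add: pos_roots_def)
  \<comment> \<open>For p < q, commuting the raising operator to the right leaves the difference of
    two diagonal matrix units; for q < p the inner operator is itself raising and kills v.\<close>
  have "unit_op n p q (unit_op n q p v) a = (if p = q then (real (occ n a p))\<^sup>2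
      else if p < q then real (occ n a p) - real (occ n a q) else 0) * v a" if "p \<in> P" "q \<in> P" for p q
  proof -
    consider "p = q" | "p < q" | "q < p" by linarith
    then show ?thesis
    proof cases
      case 1
      then show ?thesis by (simp add: unit_op_diag power2_eq_square)
    next
      case 2
      then show ?thesis
        using that by (subst unit_op_commutator) (simp add: hw' unit_op_diag left_diff_distrib)
    next
      case 3
      then show ?thesis using that by (simp add: hw')
    qed
  qed
  then have "(\<Sum>p\<in>P. \<Sum>q\<in>P. unit_op n p q (unit_op n q p v) a) = (\<Sum>p\<in>P. \<Sum>q\<in>P. if p = q then (real (occ n a p))\<^sup>2
      else if p < q then real (occ n a p) - real (occ n a q) else 0) * v a"
    by (simp add: sum_distrib_right)
  then show ?thesis
    using casimir[OF P True, of v] by (simp add: casimir_val_def field_simps)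
qed

lemma shift_prod_pointwise:
  assumes "subspace V" "\<And>v. v \<in> V \<Longrightarrow> Q v \<in> V" "\<And>v a. v \<in> V \<Longrightarrow> Q v a = c a * v a" "v \<in> V"
  shows "shift_prod Q cs v a = (\<Prod>k\<leftarrow>cs. c a - k) * (v a :: real)"
  using assms(4)
proof (induction cs arbitrary: v)
  case (Cons k cs)
  then have "Q v - k *\<^sub>R v \<in> V" using assms(1,2) by (intro subspace_diff subspace_scale)
  note Cons.IH[OF this]
  also have "(Q v - k *\<^sub>R v) a = (c a - k) * v a"
    using assms(3)[OF Cons.prems] by (simp add: left_diff_distrib)
  finally show ?case by (simp only: shift_prod.simps list.map prod_list.Cons mult_ac)
qed simp

section \<open>Symmetry and diagonalisation of the sum of transpositions\<close>

lemma sum_swap_symmetric: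
  assumes "x \<in> {1..n}" "y \<in> {1..n}"
  shows "(\<Sum>a\<in>PiE {1..n} (\<lambda>_. P). f (a(x := a y, y := a x)) * g a)
       = (\<Sum>a\<in>PiE {1..n} (\<lambda>_. P). f a * g (a(x := a y, y := a x)) :: real)"
proof -
  let ?X = "PiE {1..n} (\<lambda>_. P)" and ?s = "\<lambda>a. a(x := a y, y := a x)"
  have inv: "?s (?s a) = a" for a by (auto simp: fun_eq_iff)
  have "?s ` ?X \<subseteq> ?X" by (rule image_subsetI) (simp only: swap_in_PiE_iff[OF assms])
  then have "bij_betw ?s ?X ?X" by (intro bij_betw_byWitness[where f' = ?s]) (simp_all add: inv)
  from sum.reindex_bij_betw[OF this, of "\<lambda>a. f (?s a) * g a"] show ?thesis
    by (simp only: inv)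
qed

lemma swap_sum_symmetric:
  "(\<Sum>a\<in>PiE {1..n} (\<lambda>_. P). swap_sum n f a * g a) = (\<Sum>a\<in>PiE {1..n} (\<lambda>_. P). f a * swap_sum n g a)"
proof -
  let ?X = "PiE {1..n} (\<lambda>_. P)"
  have "(\<Sum>a\<in>?X. swap_sum n f a * g a) = (\<Sum>e\<in>edges n. \<Sum>a\<in>?X. f (a(fst e := a (snd e), snd e := a (fst e))) * g a)"
    unfolding swap_sum_def sum_distrib_right case_prod_unfold by (rule sum.swap)
  also have "\<dots> = (\<Sum>e\<in>edges n. \<Sum>a\<in>?X. f a * g (a(fst e := a (snd e), snd e := a (fst e))))"
    by (intro sum.cong refl sum_swap_symmetric) (auto dest: edges_mem)
  also have "\<dots> = (\<Sum>a\<in>?X. f a * swap_sum n g a)"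
    unfolding swap_sum_def sum_distrib_left case_prod_unfold by (rule sum.swap)
  finally show ?thesis .
qed

text \<open>A polynomial in a symmetric operator is symmetric, its factors being interchangeable.
  For finite P it follows that a supported function killed by two applications of the polynomial is
  killed by one.\<close>

lemma shift_prod_swap_sum_symmetric:
  "(\<Sum>a\<in>PiE {1..n} (\<lambda>_. P). shift_prod (swap_sum n) cs f a * g a)
     = (\<Sum>a\<in>PiE {1..n} (\<lambda>_. P). f a * shift_prod (swap_sum n) cs g a)"
proof (induction cs arbitrary: f)
  case (Cons c cs)
  let ?X = "PiE {1..n} (\<lambda>_. P)" and ?h = "shift_prod (swap_sum n) cs g"
  have "(\<Sum>a\<in>?X. shift_prod (swap_sum n) (c # cs) f a * g a)
      = (\<Sum>a\<in>?X. swap_sum n f a * ?h a) - c * (\<Sum>a\<in>?X. f a * ?h a)"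
    unfolding shift_prod.simps Cons.IH
    by (simp add: left_diff_distrib sum_subtractf sum_distrib_left mult.assoc)
  also have "\<dots> = (\<Sum>a\<in>?X. f a * (swap_sum n ?h - c *\<^sub>R ?h) a)"
    unfolding swap_sum_symmetric
    by (simp add: right_diff_distrib sum_subtractf sum_distrib_left mult_ac)
  also have "swap_sum n ?h - c *\<^sub>R ?h = shift_prod (swap_sum n) (c # cs) g"
  proof -
    let ?L = "\<lambda>v. swap_sum n v - c *\<^sub>R v"
    have "linear ?L"
      using linear_swap_sum by (intro linear_compose_sub linear_compose_scale_right) (auto simp: linear_ident)
    then have "?L ?h = shift_prod (swap_sum n) cs (?L g)"
      by (rule shift_prod_commute) (simp add: linear_diff[OF linear_swap_sum] linear_scale[OF linear_swap_sum])
    then show ?thesis by simp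
  qed
  finally show ?case .
qed simp

lemma subspace_joint_kernel:
  assumes "subspace F" "\<And>r. r \<in> A \<Longrightarrow> linear (E r)"
  shows "subspace {v \<in> F. \<forall>r\<in>A. E r v = 0}"
  using assms by (auto simp: subspace_def linear_0 linear_add linear_scale)

text \<open>On the joint kernel of the raising operators \<open>swap_sum\<close> multiplies
  pointwise by \<open>casimir_val\<close>, all of whose values are roots in \<open>cs\<close>. The
  claim then climbs to the whole space as the operators are dropped one at a time.\<close>

lemma shift_prod_swap_sum_annihilates:
  assumes P: "finite P" and cs: "set cs = casimir_val P n ` PiE {1..n} (\<lambda>_. P)"
    and v: "v \<in> supported (PiE {1..n} (\<lambda>_. P))"
  shows "shift_prod (swap_sum n) cs v = 0"
proof -
  define X where "X = PiE {1..n} (\<lambda>_. P)"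
  define E where "E = (\<lambda>r. unit_op n (fst r) (snd r) :: ((nat \<Rightarrow> real) \<Rightarrow> real) \<Rightarrow> _)"
  let ?p = "shift_prod (swap_sum n) cs" and ?F = "supported X" and ?R = "pos_roots P"
  have linE: "linear (E r)" for r unfolding E_def by (rule linear_unit_op)
  have EQ: "E r (swap_sum n v) = swap_sum n (E r v)" for r v
    unfolding E_def by (rule unit_op_swap_sum)
  have sub: "subspace {v \<in> ?F. \<forall>r\<in>A. E r v = 0}" for A
    by (intro subspace_joint_kernel subspace_supported linE)
  have inv: "swap_sum n v \<in> {v \<in> ?F. \<forall>r\<in>A. E r v = 0}" if "v \<in> {v \<in> ?F. \<forall>r\<in>A. E r v = 0}" for A v
    using that swap_sum_supported[of v n P] by (auto simp: EQ X_def linear_0[OF linear_swap_sum])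
  have "\<forall>v\<in>?F. ?p v = 0"
  proof (rule joint_kernel_induct[where R = ?R and E = E and ht = "\<lambda>r. snd r - fst r"
        and P = "\<lambda>_ V. \<forall>v\<in>V. ?p v = 0"])
    show "finite ?R" using P by (rule finite_pos_roots)
    show "E r v \<in> ?F" if "r \<in> ?R" "v \<in> ?F" for r v
      using that unit_op_supported unfolding E_def X_def pos_roots_def by auto
    show "E r (E s v) = 0" if "r \<in> ?R" "s \<in> ?R" "E r v = 0"
      "\<And>t. t \<in> ?R \<Longrightarrow> snd t - fst t > snd s - fst s \<Longrightarrow> E t v = 0" for r s v
      using that unit_op_pos_roots_commute[of "fst r" "snd r" P "fst s" "snd s" n v]
      by (simp add: E_def)
    show "\<forall>v\<in>{v \<in> ?F. \<forall>r\<in>?R. E r v = 0}. ?p v = 0"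
    proof
      fix v assume hv: "v \<in> {v \<in> ?F. \<forall>r\<in>?R. E r v = 0}"
      have "?p v a = 0" for a
      proof -
        have "?p v a = (\<Prod>k\<leftarrow>cs. casimir_val P n a - k) * v a"
        proof (rule shift_prod_pointwise[OF sub inv _ hv])
          show "swap_sum n w a = casimir_val P n a * w a" if "w \<in> {v \<in> ?F. \<forall>r\<in>?R. E r v = 0}" for w a
            using that by (intro swap_sum_highest_weight[OF P]) (auto simp only: E_def X_def mem_Collect_eq)
        qed
        moreover have "(\<Prod>k\<leftarrow>cs. casimir_val P n a - k) = 0" if "a \<in> X"
          using that cs by (simp add: prod_list_zero_iff X_def)
        moreover have "v a = 0" if "a \<notin> X" using that hv by (simp add: supported_def)
        ultimately show ?thesis by auto
      qed
      then show "?p v = 0" by (simp add: fun_eq_iff)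
    qed
    fix j s A
    assume s: "s \<in> ?R" and pres: "\<And>v. v \<in> ?F \<Longrightarrow> \<forall>r\<in>A. E r v = 0 \<Longrightarrow> \<forall>r\<in>A. E r (E s v) = 0"
      and IH: "\<forall>v\<in>{v \<in> ?F. \<forall>r\<in>insert s A. E r v = 0}. ?p v = 0"
    let ?V = "{v \<in> ?F. \<forall>r\<in>A. E r v = 0}"
    have EV: "E s v \<in> ?V" if "v \<in> ?V" for v
      using that pres[of v] s unit_op_supported[of v n P "fst s" "snd s"]
      by (auto simp: E_def X_def pos_roots_def)
    \<comment> \<open>Induction on k. The polynomial kills \<open>E s v\<close> and commutes with
      \<open>E s\<close>, so it sends v into the smaller kernel, where it vanishes again. By
      symmetry the sum of squares of \<open>?p v\<close> is then 0.\<close>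
    have "?p v = 0" if "v \<in> ?V" "(E s ^^ k) v = 0" for k v
      using that
    proof (induction k arbitrary: v)
      case 0
      then show ?case using shift_prod_zero[OF linear_swap_sum, of n cs] by (simp add: zero_fun_def)
    next
      case (Suc k)
      have "(E s ^^ k) (E s v) = 0" using Suc.prems(2) by (simp add: funpow_swap1 zero_fun_def)
      with EV[OF Suc.prems(1)] have "?p (E s v) = 0" by (rule Suc.IH)
      then have "E s (?p v) = 0"
        by (simp add: shift_prod_commute[OF linE] EQ)
      moreover have pv: "?p v \<in> ?V" using sub inv Suc.prems(1) by (rule shift_prod_in)
      ultimately have "?p (?p v) = 0" using IH by simp
      then have "(\<Sum>a\<in>X. (?p v a)\<^sup>2) = 0"
        using shift_prod_swap_sum_symmetric[of n cs v "?p v" P] by (simp add: power2_eq_square X_def)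
      moreover have "finite X" using P by (simp add: X_def finite_PiE)
      ultimately have "\<forall>a\<in>X. ?p v a = 0"
        by (subst (asm) sum_nonneg_eq_0_iff) auto
      then show "?p v = 0" using pv by (auto simp: supported_def fun_eq_iff)
    qed
    moreover have "(E s ^^ Suc n) v = 0" for v
      using s unit_op_nilpotent[of "fst s" "snd s" n v] by (auto simp: E_def pos_roots_def simp del: funpow.simps)
    ultimately show "\<forall>v\<in>?V. ?p v = 0" by blast
  qed
  then show ?thesis using v by (simp add: X_def)
qed

text \<open>The eigenspace is stable under the raising operators, which commute with
  \<open>swap_sum\<close>. In their joint kernel an eigenfunction vanishes wherever
  \<open>casimir_val\<close> differs from q, which gives the count of configurations. Each dropped
  operator contributes one factor \<open>Suc n\<close> by nilpotency.\<close>

lemma eigenspace_span_bound: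
  assumes P: "finite P"
  shows "\<exists>B. finite B \<and> card B \<le> Suc n ^ card (pos_roots P) * card {a \<in> PiE {1..n} (\<lambda>_. P). casimir_val P n a = q}
    \<and> {v \<in> supported (PiE {1..n} (\<lambda>_. P)). swap_sum n v = q *\<^sub>R v} \<subseteq> span B"
proof -
  define X where "X = PiE {1..n} (\<lambda>_. P)"
  define E where "E = (\<lambda>r. unit_op n (fst r) (snd r) :: ((nat \<Rightarrow> real) \<Rightarrow> real) \<Rightarrow> _)"
  define F where "F = {v \<in> supported X. swap_sum n v = q *\<^sub>R v}"
  let ?R = "pos_roots P" and ?d = "card {a \<in> X. casimir_val P n a = q}"
  have finX: "finite X" using P by (simp add: X_def finite_PiE)
  have linE: "linear (E r)" for r unfolding E_def by (rule linear_unit_op)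
  have EQ: "E r (swap_sum n v) = swap_sum n (E r v)" for r v
    unfolding E_def by (rule unit_op_swap_sum)
  have subF: "subspace F"
    using subspace_supported[of X]
    by (auto simp: F_def subspace_def linear_0[OF linear_swap_sum] linear_add[OF linear_swap_sum]
        linear_scale[OF linear_swap_sum] scaleR_add_right)
  have EF: "E r v \<in> F" if "r \<in> ?R" "v \<in> F" for r v
    using that unit_op_supported[of v n P "fst r" "snd r"]
    by (auto simp: F_def E_def[symmetric] X_def pos_roots_def linear_scale[OF linE] simp flip: EQ) (auto simp: E_def)
  have "\<exists>B. finite B \<and> card B \<le> Suc n ^ card ?R * ?d \<and> F \<subseteq> span B"
  proof (rule joint_kernel_induct[where R = ?R and E = E and ht = "\<lambda>r. snd r - fst r"
        and P = "\<lambda>j V. \<exists>B. finite B \<and> card B \<le> Suc n ^ j * ?d \<and> V \<subseteq> span B"])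
    show "finite ?R" using P by (rule finite_pos_roots)
    show "E r v \<in> F" if "r \<in> ?R" "v \<in> F" for r v by (rule EF[OF that])
    show "E r (E s v) = 0" if "r \<in> ?R" "s \<in> ?R" "E r v = 0"
      "\<And>t. t \<in> ?R \<Longrightarrow> snd t - fst t > snd s - fst s \<Longrightarrow> E t v = 0" for r s v
      using that unit_op_pos_roots_commute[of "fst r" "snd r" P "fst s" "snd s" n v]
      by (simp add: E_def)
    show "\<exists>B. finite B \<and> card B \<le> Suc n ^ 0 * ?d \<and> {v \<in> F. \<forall>r\<in>?R. E r v = 0} \<subseteq> span B"
    proof (intro exI conjI)
      let ?Y = "{a \<in> X. casimir_val P n a = q}"
      show "finite (point ` ?Y)" "card (point ` ?Y) \<le> Suc n ^ 0 * ?d"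
        using finX by (auto intro: card_image_le)
      have "v \<in> supported ?Y" if v: "v \<in> F" "\<forall>r\<in>?R. E r v = 0" for v
      proof -
        have "casimir_val P n a * v a = q * v a" for a
        proof -
          have A: "swap_sum n v a = casimir_val P n a * v a"
            using v by (intro swap_sum_highest_weight[OF P]) (auto simp only: E_def X_def F_def mem_Collect_eq)
          have "swap_sum n v a = q * v a" using v(1) by (simp add: F_def)
          then show ?thesis unfolding A .
        qed
        then show ?thesis using v(1) by (auto simp: supported_def F_def)
      qed
      then show "{v \<in> F. \<forall>r\<in>?R. E r v = 0} \<subseteq> span (point ` ?Y)"
        using supported_span[of ?Y] finX by auto
    qed
    fix j s A
    assume s: "s \<in> ?R" and pres: "\<And>v. v \<in> F \<Longrightarrow> \<forall>r\<in>A. E r v = 0 \<Longrightarrow> \<forall>r\<in>A. E r (E s v) = 0"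
      and IH: "\<exists>B. finite B \<and> card B \<le> Suc n ^ j * ?d \<and> {v \<in> F. \<forall>r\<in>insert s A. E r v = 0} \<subseteq> span B"
    let ?V = "{v \<in> F. \<forall>r\<in>A. E r v = 0}"
    from IH obtain B where B: "finite B" "card B \<le> Suc n ^ j * ?d"
      "{v \<in> F. \<forall>r\<in>insert s A. E r v = 0} \<subseteq> span B" by blast
    have "\<exists>B'. finite B' \<and> card B' \<le> Suc n * card B \<and> ?V \<subseteq> span B'"
    proof (rule nilpotent_span_bound[OF linE[of s]])
      show "subspace ?V" by (intro subspace_joint_kernel subF linE)
      show "E s v \<in> ?V" if "v \<in> ?V" for v using that pres[of v] s EF by auto
      show "(E s ^^ Suc n) v = 0" for v
        using s unit_op_nilpotent[of "fst s" "snd s" n v] by (auto simp: E_def pos_roots_def simp del: funpow.simps)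
      show "{v \<in> ?V. E s v = 0} \<subseteq> span B" using B(3) by auto
    qed (rule B(1))
    moreover have "Suc n * card B \<le> Suc n ^ Suc j * ?d"
      using mult_le_mono2[OF B(2), of "Suc n"] by (simp only: power_Suc mult.assoc)
    ultimately show "\<exists>B. finite B \<and> card B \<le> Suc n ^ Suc j * ?d \<and> ?V \<subseteq> span B"
      using le_trans by blast
  qed
  then show ?thesis by (simp only: F_def X_def)
qed

text \<open>An annihilating polynomial with distinct roots makes the eigenvectors span, and a basis
  is extracted from them. Its members with eigenvalue q are independent within one eigenspace, which
  bounds their number.\<close>

lemma swap_sum_eigenbasis:
  assumes P: "finite P"
  obtains B ev where "independent B" "B \<subseteq> supported (PiE {1..n} (\<lambda>_. P))"
    "supported (PiE {1..n} (\<lambda>_. P)) \<subseteq> span B" "finite B"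
    "\<forall>b\<in>B. swap_sum n b = ev b *\<^sub>R b"
    "\<forall>q. card {b \<in> B. ev b = q} \<le> Suc n ^ card (pos_roots P) * card {a \<in> PiE {1..n} (\<lambda>_. P). casimir_val P n a = q}"
proof -
  define X where "X = PiE {1..n} (\<lambda>_. P)"
  have finX: "finite X" using P by (simp add: X_def finite_PiE)
  obtain cs where cs: "set cs = casimir_val P n ` X" "distinct cs"
    using finite_distinct_list[of "casimir_val P n ` X"] finX by auto
  define G where "G = {g \<in> supported X. \<exists>c\<in>set cs. swap_sum n g = c *\<^sub>R g}"
  have "supported X \<subseteq> span G"
    unfolding G_def
    by (intro subsetI in_span_eigenvectors linear_swap_sum subspace_supported cs(2))
      (use swap_sum_supported[of _ n P] shift_prod_swap_sum_annihilates[OF P cs(1)[unfolded X_def]] in \<open>simp_all only: X_def\<close>)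
  moreover obtain B where B: "B \<subseteq> G" "independent B" "G \<subseteq> span B"
    using maximal_independent_subset by blast
  ultimately have span: "supported X \<subseteq> span B" using span_minimal[of G "span B"] by auto
  have "\<forall>b\<in>B. \<exists>c. swap_sum n b = c *\<^sub>R b" using B(1) by (auto simp: G_def)
  then obtain ev where ev: "\<And>b. b \<in> B \<Longrightarrow> swap_sum n b = ev b *\<^sub>R b" by metis
  have BX: "B \<subseteq> supported X" using B(1) by (auto simp: G_def)
  have bound: "card {b \<in> B. ev b = q} \<le> Suc n ^ card (pos_roots P) * card {a \<in> X. casimir_val P n a = q}" for q
  proof -
    obtain C where C: "finite C" "card C \<le> Suc n ^ card (pos_roots P) * card {a \<in> X. casimir_val P n a = q}"
      "{v \<in> supported X. swap_sum n v = q *\<^sub>R v} \<subseteq> span C"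
      using eigenspace_span_bound[OF P, of n q] unfolding X_def by blast
    have "{b \<in> B. ev b = q} \<subseteq> span C" using C(3) BX ev by auto
    moreover have "independent {b \<in> B. ev b = q}" using B(2) by (rule independent_mono) auto
    ultimately show ?thesis using independent_span_bound[OF C(1)] C(2) le_trans by blast
  qed
  show thesis
    using that[OF B(2)] ev BX span bound finite_independent_supported[OF finX B(2) BX]
    unfolding X_def by blast
qed

lemma sum_fibres:
  fixes g :: "real \<Rightarrow> real"
  assumes "finite S" "finite T" "h ` S \<subseteq> T"
  shows "(\<Sum>b\<in>S. g (h b)) = (\<Sum>q\<in>T. real (card {b \<in> S. h b = q}) * g q)"
proof -
  have "(\<Sum>b\<in>S. g (h b)) = (\<Sum>q\<in>T. \<Sum>b\<in>{b \<in> S. h b = q}. g (h b))"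
    using assms by (rule sum.group[symmetric])
  also have "\<dots> = (\<Sum>q\<in>T. real (card {b \<in> S. h b = q}) * g q)" by (intro sum.cong) auto
  finally show ?thesis .
qed

text \<open>Grouping both sums by value turns a bound on eigenvalue multiplicities into a bound on
  traces.\<close>

lemma sum_le_of_card_fibres_le:
  fixes g :: "real \<Rightarrow> real"
  assumes fin: "finite B" "finite X" and g: "\<And>q. 0 \<le> g q"
    and card: "\<And>q. card {b \<in> B. ev b = q} \<le> K * card {a \<in> X. c a = q}"
  shows "(\<Sum>b\<in>B. g (ev b)) \<le> real K * (\<Sum>a\<in>X. g (c a))"
proof -
  let ?T = "ev ` B \<union> c ` X"
  have "(\<Sum>b\<in>B. g (ev b)) = (\<Sum>q\<in>?T. real (card {b \<in> B. ev b = q}) * g q)"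
    using fin by (intro sum_fibres) auto
  also have "\<dots> \<le> (\<Sum>q\<in>?T. real (K * card {a \<in> X. c a = q}) * g q)"
    by (intro sum_mono mult_right_mono g) (use card of_nat_le_iff in blast)
  also have "\<dots> = real K * (\<Sum>q\<in>?T. real (card {a \<in> X. c a = q}) * g q)"
    by (simp add: sum_distrib_left mult.assoc)
  also have "(\<Sum>q\<in>?T. real (card {a \<in> X. c a = q}) * g q) = (\<Sum>a\<in>X. g (c a))"
    using fin by (intro sum_fibres[symmetric]) auto
  finally show ?thesis .
qed

section \<open>Comparison with the classical mean-field Potts model\<close>

definition swap_mat :: "nat \<Rightarrow> mat" where
  "swap_mat n b a = (\<Sum>(x, y)\<in>edges n. transp_op x y b a)"

text \<open>The sum of squares counts the ordered pairs of sites with equal spin, each site paired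
  with itself included. Up to the factor exp (\<beta> / 2) this is the Potts model on the complete
  graph with coupling \<beta> / n per edge.\<close>

definition potts_sum :: "real set \<Rightarrow> real \<Rightarrow> nat \<Rightarrow> real" where
  "potts_sum P \<beta> n = (\<Sum>a\<in>PiE {1..n} (\<lambda>_. P). exp (\<beta> / (2 * real n) * (\<Sum>p\<in>P. (real (occ n a p))\<^sup>2)))"

lemma ham_eq: "ham S n b a = real (card (edges n)) * id_op b a - swap_mat n b a"
  by (simp add: ham_def swap_mat_def case_prod_unfold sum_subtractf)

lemma swap_mat_nonneg: "0 \<le> swap_mat n b a"
  by (auto simp: swap_mat_def transp_op_def intro!: sum_nonneg)

lemma swap_mat_apply:
  assumes P: "finite P" and a: "a \<in> PiE {1..n} (\<lambda>_. P)"
  shows "(\<Sum>c\<in>PiE {1..n} (\<lambda>_. P). swap_mat n a c * f c) = swap_sum n f a"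
proof -
  let ?X = "PiE {1..n} (\<lambda>_. P)"
  have "(\<Sum>c\<in>?X. swap_mat n a c * f c) = (\<Sum>e\<in>edges n. \<Sum>c\<in>?X. transp_op (fst e) (snd e) a c * f c)"
    unfolding swap_mat_def sum_distrib_right case_prod_unfold by (rule sum.swap)
  also have "\<dots> = (\<Sum>e\<in>edges n. f (a(fst e := a (snd e), snd e := a (fst e))))"
  proof (rule sum.cong)
    fix e assume "e \<in> edges n"
    then obtain x y where e: "e = (x, y)" "x \<in> {1..n}" "y \<in> {1..n}" by (cases e) (auto dest: edges_mem)
    let ?b = "a(x := a y, y := a x)"
    have "?b \<in> ?X" using a e(2,3) by (simp only: swap_in_PiE_iff)
    moreover have "a = c(x := c y, y := c x) \<longleftrightarrow> c = ?b" for c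
      by (metis swap_swap)
    then have "(\<Sum>c\<in>?X. transp_op x y a c * f c) = (\<Sum>c\<in>?X. if c = ?b then f c else 0)"
      by (auto simp: transp_op_def intro!: sum.cong)
    ultimately have "(\<Sum>c\<in>?X. transp_op x y a c * f c) = f ?b"
      using P by (simp add: finite_PiE del: PiE_iff)
    then show "(\<Sum>c\<in>?X. transp_op (fst e) (snd e) a c * f c) = f (a(fst e := a (snd e), snd e := a (fst e)))"
      by (simp add: e(1))
  qed simp
  finally show ?thesis by (simp add: swap_sum_def case_prod_unfold)
qed

text \<open>The diagonal entry counts the edges whose endpoints agree; a site x lies on
  \<open>occ n a (a x) - 1\<close> of them, and each edge is seen from both ends.\<close>

lemma swap_mat_diag:
  assumes P: "finite P" and a: "a \<in> PiE {1..n} (\<lambda>_. P)"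
  shows "swap_mat n a a = ((\<Sum>p\<in>P. (real (occ n a p))\<^sup>2) - real n) / 2"
proof -
  let ?g = "\<lambda>x y. if a x = a y then 1 else 0 :: real"
  have "2 * swap_mat n a a = 2 * (\<Sum>(x, y)\<in>edges n. ?g x y)"
    unfolding swap_mat_def transp_op_def by (auto simp: fun_eq_iff intro!: sum.cong)
  also have "\<dots> = (\<Sum>x=1..n. \<Sum>y\<in>{1..n}-{x}. ?g x y)"
    by (rule sum_pairs_edges[symmetric]) auto
  also have "\<dots> = (\<Sum>x=1..n. real (occ n a (a x)) - 1)"
  proof (rule sum.cong)
    fix x assume "x \<in> {1..n}"
    then have "(\<Sum>y=1..n. ?g x y) = 1 + (\<Sum>y\<in>{1..n}-{x}. ?g x y)" by (subst sum.remove[of _ x]) auto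
    moreover have "(\<Sum>y=1..n. ?g x y) = real (occ n a (a x))"
      unfolding occ_eq_sum by (auto intro!: sum.cong)
    ultimately show "(\<Sum>y\<in>{1..n}-{x}. ?g x y) = real (occ n a (a x)) - 1" by simp
  qed simp
  also have "\<dots> = (\<Sum>x=1..n. real (occ n a (a x))) - real n" by (simp add: sum_subtractf)
  also have "(\<Sum>x=1..n. real (occ n a (a x))) = (\<Sum>p\<in>P. (real (occ n a p))\<^sup>2)"
    unfolding sum_over_sites[OF P a, of "\<lambda>p. real (occ n a p)"] power2_eq_square ..
  finally show ?thesis by simp
qed

text \<open>The first-order terms are at most \<open>card P\<close> times the total occupation n,
  which is exactly what \<open>casimir_val\<close> subtracts.\<close>

lemma casimir_val_le:
  assumes P: "finite P" and a: "a \<in> PiE {1..n} (\<lambda>_. P)"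
  shows "casimir_val P n a \<le> (\<Sum>p\<in>P. (real (occ n a p))\<^sup>2) / 2"
proof -
  have "(\<Sum>p\<in>P. \<Sum>q\<in>P. if p = q then (real (occ n a p))\<^sup>2
      else if p < q then real (occ n a p) - real (occ n a q) else 0)
    \<le> (\<Sum>p\<in>P. \<Sum>q\<in>P. (if p = q then (real (occ n a p))\<^sup>2 else 0) + real (occ n a p))"
    by (intro sum_mono) auto
  also have "\<dots> = (\<Sum>p\<in>P. (real (occ n a p))\<^sup>2) + real (card P) * (\<Sum>p\<in>P. real (occ n a p))"
    using P by (simp add: sum.distrib sum_distrib_left)
  finally show ?thesis by (simp add: casimir_val_def sum_occ[OF assms])
qed

text \<open>With N edges and t = \<beta> / n, the trace is exp (- t N) times the trace of exp (t Q),
  and t N = \<beta> (n - 1) / 2. The first bound comes from the diagonal entries of Q, the second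
  from its eigenvalue multiplicities.\<close>

lemma partition_fn_bounds:
  assumes n: "n > 0" and \<beta>: "\<beta> \<ge> 0" and P: "finite (spins S)"
  shows "exp (- \<beta> * real n / 2) * potts_sum (spins S) \<beta> n \<le> partition_fn S \<beta> n"
    and "partition_fn S \<beta> n \<le> real (Suc n) ^ card (pos_roots (spins S))
           * exp (\<beta> / 2 - \<beta> * real n / 2) * potts_sum (spins S) \<beta> n"
proof -
  define P where "P = spins S"
  define X where "X = PiE {1..n} (\<lambda>_. P)"
  define t where "t = \<beta> / real n"
  define N where "N = real (card (edges n))"
  have finP: "finite P" using P by (simp add: P_def)
  have finX: "finite X" using finP by (simp add: X_def finite_PiE)
  have t0: "t \<ge> 0" using \<beta> by (simp add: t_def)
  have tN: "t * N = \<beta> * real n / 2 - \<beta> / 2"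
  proof -
    have "t * N = \<beta> / (2 * real n) * (real n * (real n - 1))"
      unfolding card_edges[symmetric] by (simp add: t_def N_def)
    also have "\<dots> = \<beta> * (real n - 1) / 2" using n by simp
    finally show ?thesis by (simp add: field_simps)
  qed
  obtain B ev where B: "independent B" "B \<subseteq> supported X" "supported X \<subseteq> span B" "finite B"
    and ev: "\<forall>b\<in>B. swap_sum n b = ev b *\<^sub>R b"
    and card: "\<forall>q. card {b \<in> B. ev b = q} \<le> Suc n ^ card (pos_roots P) * card {a \<in> X. casimir_val P n a = q}"
    by (rule swap_sum_eigenbasis[OF finP, of n, folded X_def]) (rule that)
  have app: "(\<Sum>c\<in>X. swap_mat n a c * b c) = ev b * b a" if "b \<in> B" "a \<in> X" for a b
    using swap_mat_apply[OF finP, of a n b] that ev by (simp add: X_def)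
  have Z: "partition_fn S \<beta> n = (\<Sum>b\<in>B. exp (t * (ev b - N)))"
    unfolding partition_fn_def configs_def P_def[symmetric] X_def[symmetric]
  proof (rule trace_exp_eigenbasis[OF finX B(1-3)])
    fix b a assume ba: "b \<in> B" "a \<in> X"
    have "(\<Sum>c\<in>X. - (\<beta> / real n) * ham S n a c * b c)
      = t * ((\<Sum>c\<in>X. swap_mat n a c * b c) - N * (\<Sum>c\<in>X. if c = a then b c else 0))"
      unfolding sum_distrib_left sum_subtractf[symmetric]
      by (intro sum.cong) (auto simp: ham_eq t_def N_def id_op_def algebra_simps)
    also have "\<dots> = t * (ev b - N) * b a"
      using app[OF ba] ba(2) finX by (simp only:) (simp add: algebra_simps)
    finally show "(\<Sum>c\<in>X. - (\<beta> / real n) * ham S n a c * b c) = t * (ev b - N) * b a" .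
  qed
  have Z': "partition_fn S \<beta> n = exp (- (t * N)) * (\<Sum>b\<in>B. exp (t * ev b))"
    unfolding Z sum_distrib_left by (simp add: right_diff_distrib flip: exp_add)
  have W: "potts_sum P \<beta> n = (\<Sum>a\<in>X. exp (t * ((\<Sum>p\<in>P. (real (occ n a p))\<^sup>2) / 2)))"
    by (simp add: potts_sum_def X_def t_def field_simps)
  have "(\<Sum>a\<in>X. exp (t * swap_mat n a a)) \<le> (\<Sum>b\<in>B. exp (t * ev b))"
  proof (rule sum_exp_diag_le[OF finX, where A = "\<lambda>a c. t * swap_mat n a c"])
    show "0 \<le> t * swap_mat n a c" for a c using t0 by (simp add: swap_mat_nonneg)
    show "(\<lambda>k. mat_trace X (mat_pow X (\<lambda>a c. t * swap_mat n a c) k) / fact k) sums (\<Sum>b\<in>B. exp (t * ev b))"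
      by (rule trace_exp_eigenbasis_sums[OF finX B(1-3)])
        (simp add: app mult.assoc flip: sum_distrib_left)
  qed
  \<comment> \<open>The factor exp (- \<beta> / 2) removes the pairing of each of the n sites with
    itself, which the Potts exponent contains and the diagonal entry does not.\<close>
  also have "(\<Sum>a\<in>X. exp (t * swap_mat n a a)) = exp (- \<beta> / 2) * potts_sum P \<beta> n"
    unfolding W sum_distrib_left
  proof (rule sum.cong)
    fix a assume "a \<in> X"
    then have "t * swap_mat n a a = t * ((\<Sum>p\<in>P. (real (occ n a p))\<^sup>2) / 2) - \<beta> / 2"
      using swap_mat_diag[OF finP, of a n] n
      by (simp add: X_def t_def right_diff_distrib diff_divide_distrib)
    then show "exp (t * swap_mat n a a) = exp (- \<beta> / 2) * exp (t * ((\<Sum>p\<in>P. (real (occ n a p))\<^sup>2) / 2))"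
      by (simp flip: exp_add)
  qed simp
  finally have "exp (- (t * N)) * (exp (- \<beta> / 2) * potts_sum P \<beta> n) \<le> partition_fn S \<beta> n"
    unfolding Z' by (intro mult_left_mono) auto
  moreover have "exp (- (t * N)) * exp (- \<beta> / 2) = exp (- \<beta> * real n / 2)"
    by (simp add: tN flip: exp_add)
  ultimately show "exp (- \<beta> * real n / 2) * potts_sum (spins S) \<beta> n \<le> partition_fn S \<beta> n"
    by (simp add: P_def mult.assoc[symmetric])
  have "(\<Sum>b\<in>B. exp (t * ev b)) \<le> real (Suc n ^ card (pos_roots P)) * (\<Sum>a\<in>X. exp (t * casimir_val P n a))"
    by (rule sum_le_of_card_fibres_le[OF B(4) finX _ card[rule_format]]) simp
  also have "\<dots> \<le> real (Suc n ^ card (pos_roots P)) * potts_sum P \<beta> n"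
    unfolding W using casimir_val_le[OF finP, of _ n] t0
    by (intro mult_left_mono sum_mono) (auto simp only: X_def exp_le_cancel_iff of_nat_0_le_iff intro!: mult_left_mono)
  finally have "partition_fn S \<beta> n \<le> exp (- (t * N)) * (real (Suc n ^ card (pos_roots P)) * potts_sum P \<beta> n)"
    unfolding Z' by (intro mult_left_mono) auto
  then show "partition_fn S \<beta> n \<le> real (Suc n) ^ card (pos_roots (spins S))
           * exp (\<beta> / 2 - \<beta> * real n / 2) * potts_sum (spins S) \<beta> n"
    unfolding tN by (simp add: P_def mult_ac)
qed

section \<open>Solution of the mean-field Potts model\<close>

text \<open>Energy plus entropy of weights indexed by P. For the same weights it exceeds
  \<open>phi\<close> by \<beta> / 2, which cancels against the prefactor exp (- \<beta> n / 2) of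
  the partition function.\<close>

definition potts_fun :: "real set \<Rightarrow> real \<Rightarrow> (real \<Rightarrow> real) \<Rightarrow> real" where
  "potts_fun P \<beta> y = \<beta> / 2 * (\<Sum>p\<in>P. (y p)\<^sup>2) - (\<Sum>p\<in>P. y p * ln (y p))"

text \<open>With G the exponent on the left, the tangent inequality 1 + t \<le> exp t is taken at t
  = u p - ln (y p) - G and weighted by y p exp G. On summation the terms in G cancel. A zero weight
  contributes 0 on the left.\<close>

lemma gibbs_inequality:
  fixes y u :: "'a \<Rightarrow> real"
  assumes "finite P" and y: "\<And>p. p \<in> P \<Longrightarrow> 0 \<le> y p" "(\<Sum>p\<in>P. y p) = 1"
  shows "exp (\<Sum>p\<in>P. y p * (u p - ln (y p))) \<le> (\<Sum>p\<in>P. exp (u p))"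
proof -
  define G where "G = (\<Sum>p\<in>P. y p * (u p - ln (y p)))"
  have "exp G * (y p * (1 - G) + y p * (u p - ln (y p))) \<le> exp (u p)" if "p \<in> P" for p
  proof (cases "y p = 0")
    case False
    then have yp: "y p > 0" using y(1)[OF that] by simp
    have "1 + (u p - ln (y p) - G) \<le> exp (u p - ln (y p) - G)" by (rule exp_ge_add_one_self)
    then have "y p * exp G * (1 + (u p - ln (y p) - G)) \<le> y p * exp G * exp (u p - ln (y p) - G)"
      using yp by (intro mult_left_mono) auto
    also have "\<dots> = exp (u p)" using yp by (simp add: exp_diff)
    finally show ?thesis by (simp add: algebra_simps)
  qed simp
  then have "(\<Sum>p\<in>P. exp G * (y p * (1 - G) + y p * (u p - ln (y p)))) \<le> (\<Sum>p\<in>P. exp (u p))"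
    by (rule sum_mono)
  also have "(\<Sum>p\<in>P. exp G * (y p * (1 - G) + y p * (u p - ln (y p)))) = exp G * ((\<Sum>p\<in>P. y p) * (1 - G) + G)"
    by (simp add: G_def sum.distrib sum_distrib_right flip: sum_distrib_left)
  finally show ?thesis by (simp add: y(2) G_def)
qed

text \<open>Linearising the square around \<open>n y\<close> decouples the sites.\<close>

lemma potts_sum_ge:
  assumes n: "n > 0" and \<beta>: "\<beta> \<ge> 0" and P: "finite P"
    and y: "\<And>p. p \<in> P \<Longrightarrow> 0 \<le> y p" "(\<Sum>p\<in>P. y p) = 1"
  shows "exp (real n * potts_fun P \<beta> y) \<le> potts_sum P \<beta> n"
proof -
  let ?X = "PiE {1..n} (\<lambda>_. P)" and ?s = "\<Sum>p\<in>P. (y p)\<^sup>2"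
  \<comment> \<open>The one-site field \<beta> * y p carries twice the energy of y; the subtracted
    term corrects for this. The remaining sum is the exponent of Gibbs' inequality for that
    field.\<close>
  have "real n * potts_fun P \<beta> y = - (real n * \<beta> / 2 * ?s) + real n * (\<Sum>p\<in>P. y p * (\<beta> * y p - ln (y p)))"
    by (simp add: potts_fun_def right_diff_distrib sum_subtractf power2_eq_square algebra_simps flip: sum_distrib_left)
  then have "exp (real n * potts_fun P \<beta> y)
      = exp (- (real n * \<beta> / 2 * ?s)) * exp (\<Sum>p\<in>P. y p * (\<beta> * y p - ln (y p))) ^ n"
    by (simp only: exp_add exp_of_nat_mult)
  also have "\<dots> \<le> exp (- (real n * \<beta> / 2 * ?s)) * (\<Sum>p\<in>P. exp (\<beta> * y p)) ^ n"
    by (intro mult_left_mono power_mono gibbs_inequality P y) auto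
  also have "(\<Sum>p\<in>P. exp (\<beta> * y p)) ^ n = (\<Sum>a\<in>?X. \<Prod>x=1..n. exp (\<beta> * y (a x)))"
    using prod_sum_PiE[of "{1..n}" "\<lambda>_. P" "\<lambda>_ p. exp (\<beta> * y p)"] P by simp
  also have "exp (- (real n * \<beta> / 2 * ?s)) * \<dots> \<le> potts_sum P \<beta> n"
    unfolding potts_sum_def sum_distrib_left[of "exp (- (real n * \<beta> / 2 * ?s))"]
  proof (rule sum_mono)
    fix a assume a: "a \<in> ?X"
    have "2 * real n * (real (occ n a p) * y p) - (real n)\<^sup>2 * (y p)\<^sup>2 \<le> (real (occ n a p))\<^sup>2" for p
      using zero_le_power2[of "real (occ n a p) - real n * y p"] by (simp add: power2_eq_square algebra_simps)
    then have "(\<Sum>p\<in>P. 2 * real n * (real (occ n a p) * y p) - (real n)\<^sup>2 * (y p)\<^sup>2) \<le> (\<Sum>p\<in>P. (real (occ n a p))\<^sup>2)"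
      by (intro sum_mono)
    moreover have "(\<Sum>p\<in>P. 2 * real n * (real (occ n a p) * y p) - (real n)\<^sup>2 * (y p)\<^sup>2)
        = 2 * real n * (\<Sum>x=1..n. y (a x)) - (real n)\<^sup>2 * ?s"
      unfolding sum_over_sites[OF P a] sum_subtractf sum_distrib_left ..
    ultimately have "\<beta> / (2 * real n) * (2 * real n * (\<Sum>x=1..n. y (a x)) - (real n)\<^sup>2 * ?s)
        \<le> \<beta> / (2 * real n) * (\<Sum>p\<in>P. (real (occ n a p))\<^sup>2)"
      using \<beta> by (intro mult_left_mono) auto
    moreover have "\<beta> / (2 * real n) * (2 * real n * z - (real n)\<^sup>2 * ?s) = - (real n * \<beta> / 2 * ?s) + \<beta> * z" for z
      using n by (simp add: field_simps power2_eq_square)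
    ultimately have "- (real n * \<beta> / 2 * ?s) + \<beta> * (\<Sum>x=1..n. y (a x)) \<le> \<beta> / (2 * real n) * (\<Sum>p\<in>P. (real (occ n a p))\<^sup>2)"
      by metis
    then have "exp (- (real n * \<beta> / 2 * ?s) + \<beta> * (\<Sum>x=1..n. y (a x)))
        \<le> exp (\<beta> / (2 * real n) * (\<Sum>p\<in>P. (real (occ n a p))\<^sup>2))"
      by (simp only: exp_le_cancel_iff)
    then show "exp (- (real n * \<beta> / 2 * ?s)) * (\<Prod>x=1..n. exp (\<beta> * y (a x)))
        \<le> exp (\<beta> / (2 * real n) * (\<Sum>p\<in>P. (real (occ n a p))\<^sup>2))"
      by (simp only: exp_add sum_distrib_left exp_sum[OF finite_atLeastAtMost])
  qed
  finally show ?thesis .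
qed

text \<open>Draw the sites independently from the empirical distribution w of a0. All configurations
  with the occupation numbers of a0 have the same probability \<open>exp ?h\<close>, and these
  probabilities add up to at most 1.\<close>

lemma card_type_class_le:
  assumes n: "n > 0" and P: "finite P" and a0: "a0 \<in> PiE {1..n} (\<lambda>_. P)"
  shows "real (card {a \<in> PiE {1..n} (\<lambda>_. P). \<forall>p\<in>P. occ n a p = occ n a0 p})
    \<le> exp (- (\<Sum>p\<in>P. real (occ n a0 p) * ln (real (occ n a0 p) / real n)))"
proof -
  define w where "w p = real (occ n a0 p) / real n" for p
  let ?X = "PiE {1..n} (\<lambda>_. P)" and ?C = "{a \<in> PiE {1..n} (\<lambda>_. P). \<forall>p\<in>P. occ n a p = occ n a0 p}"
    and ?h = "\<Sum>p\<in>P. real (occ n a0 p) * ln (w p)"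
  have finX: "finite ?X" using P by (intro finite_PiE) auto
  have w0: "w p \<ge> 0" for p by (simp add: w_def)
  have "(\<Sum>a\<in>?C. exp ?h) = (\<Sum>a\<in>?C. \<Prod>x=1..n. w (a x))"
  proof (rule sum.cong)
    fix a assume aC: "a \<in> ?C"
    then have a: "a \<in> ?X" by (simp only: mem_Collect_eq)
    \<comment> \<open>A value taken by a is also taken by a0, so its weight is positive and the
      product can be written with logarithms.\<close>
    have "w (a x) > 0" if x: "x \<in> {1..n}" for x
    proof -
      have "a x \<in> P" using a x by (rule PiE_mem)
      then have "occ n a0 (a x) = occ n a (a x)" using aC by simp
      moreover have "occ n a (a x) > 0" using x by (auto simp: occ_def card_gt_0_iff)
      ultimately show ?thesis using n by (simp add: w_def)
    qed
    then have "(\<Prod>x=1..n. w (a x)) = exp (\<Sum>x=1..n. ln (w (a x)))"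
      by (simp add: exp_sum)
    also have "(\<Sum>x=1..n. ln (w (a x))) = ?h"
      unfolding sum_over_sites[OF P a, of "\<lambda>p. ln (w p)"] using aC by (intro sum.cong) auto
    finally show "exp ?h = (\<Prod>x=1..n. w (a x))" by (rule sym)
  qed simp
  also have "\<dots> \<le> (\<Sum>a\<in>?X. \<Prod>x=1..n. w (a x))"
    using finX by (intro sum_mono2) (auto intro!: prod_nonneg w0)
  also have "\<dots> = (\<Sum>p\<in>P. w p) ^ n"
    using prod_sum_PiE[of "{1..n}" "\<lambda>_. P" "\<lambda>_. w"] P by simp
  also have "(\<Sum>p\<in>P. w p) = 1"
    using sum_occ[OF P a0] n by (simp add: w_def flip: sum_divide_distrib)
  finally have "real (card ?C) * exp ?h \<le> 1" by simp
  then show ?thesis by (simp add: w_def exp_minus field_simps)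
qed

text \<open>Configurations are grouped by occupation numbers, with at most n + 1 choices for each
  spin value. The size bound and the common energy of a group combine to the exponential of n times
  \<open>potts_fun\<close> at its empirical distribution.\<close>

lemma potts_sum_le:
  assumes n: "n > 0" and P: "finite P"
    and M: "\<And>y. (\<And>p. p \<in> P \<Longrightarrow> 0 \<le> y p) \<Longrightarrow> (\<Sum>p\<in>P. y p) = 1 \<Longrightarrow> potts_fun P \<beta> y \<le> M"
  shows "potts_sum P \<beta> n \<le> real (Suc n) ^ card P * exp (real n * M)"
proof -
  define X where "X = PiE {1..n} (\<lambda>_. P)"
  \<comment> \<open>Restricting to P makes two types equal exactly when the counts on P agree, and
    places them in a finite product set.\<close>
  define ty where "ty a = restrict (occ n a) P" for a :: "nat \<Rightarrow> real"
  let ?e = "\<lambda>a. exp (\<beta> / (2 * real n) * (\<Sum>p\<in>P. (real (occ n a p))\<^sup>2))"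
  have finX: "finite X" using P by (simp add: X_def finite_PiE)
  have ty_eq: "ty a = ty a0 \<longleftrightarrow> (\<forall>p\<in>P. occ n a p = occ n a0 p)" for a a0
    by (auto simp: ty_def fun_eq_iff restrict_def)
  have tyT: "ty ` X \<subseteq> PiE P (\<lambda>_. {0..n})" by (auto simp: ty_def occ_le)
  have "potts_sum P \<beta> n = (\<Sum>m\<in>ty ` X. \<Sum>a\<in>{a \<in> X. ty a = m}. ?e a)"
    unfolding potts_sum_def X_def[symmetric] using finX by (intro sum.group[symmetric]) auto
  also have "\<dots> \<le> (\<Sum>m\<in>ty ` X. exp (real n * M))"
  proof (rule sum_mono)
    fix m assume "m \<in> ty ` X"
    then obtain a0 where a0: "a0 \<in> X" "m = ty a0" by auto
    define y where "y p = real (occ n a0 p) / real n" for p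
    have "(\<Sum>a\<in>{a \<in> X. ty a = m}. ?e a) = (\<Sum>a\<in>{a \<in> X. ty a = m}. ?e a0)"
      by (rule sum.cong) (auto simp: a0(2) ty_eq)
    also have "\<dots> = real (card {a \<in> X. \<forall>p\<in>P. occ n a p = occ n a0 p}) * ?e a0"
      by (simp add: a0(2) ty_eq)
    also have "\<dots> \<le> exp (- (\<Sum>p\<in>P. real (occ n a0 p) * ln (y p))) * ?e a0"
      using card_type_class_le[OF n P, of a0] a0(1) by (intro mult_right_mono) (auto simp only: X_def y_def exp_ge_zero)
    also have "\<dots> = exp (real n * potts_fun P \<beta> y)"
      unfolding exp_add[symmetric] potts_fun_def using n
      by (simp add: y_def power_divide right_diff_distrib sum_distrib_left power2_eq_square field_simps)
    also have "potts_fun P \<beta> y \<le> M"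
      using sum_occ[OF P a0(1)[unfolded X_def]] n
      by (intro M) (auto simp: y_def simp flip: sum_divide_distrib)
    finally show "(\<Sum>a\<in>{a \<in> X. ty a = m}. ?e a) \<le> exp (real n * M)" using n by simp
  qed
  also have "\<dots> = real (card (ty ` X)) * exp (real n * M)" by simp
  also have "\<dots> \<le> real (Suc n ^ card P) * exp (real n * M)"
  proof (intro mult_right_mono of_nat_mono)
    have "card (ty ` X) \<le> card (PiE P (\<lambda>_. {0..n}))" using P tyT by (intro card_mono finite_PiE) auto
    then show "card (ty ` X) \<le> Suc n ^ card P" using P by (simp add: card_PiE)
  qed simp
  finally show ?thesis by simp
qed

section \<open>The variational problem\<close>

text \<open>At 0, where HOL's \<open>ln 0 = 0\<close> gives the value 0, the bound |u ln u| \<le> 2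
  sqrt u follows from ln t \<le> t - 1 at t = 1 / sqrt u.\<close>

lemma continuous_on_x_ln_x: "continuous_on {0..} (\<lambda>x::real. x * ln x)"
  unfolding continuous_on_def
proof
  fix x :: real assume x: "x \<in> {0..}"
  show "((\<lambda>x. x * ln x) \<longlongrightarrow> x * ln x) (at x within {0..})"
  proof (cases "x = 0")
    case False
    then show ?thesis by (intro tendsto_intros) auto
  next
    case True
    have bd: "\<bar>u * ln u\<bar> \<le> 2 * sqrt u" if "0 \<le> u" "u \<le> 1" for u :: real
    proof (cases "u = 0")
      case False
      then have u: "u > 0" using that by simp
      have "ln (1 / sqrt u) \<le> 1 / sqrt u - 1" using u by (intro ln_le_minus_one) auto
      then have "- ln u \<le> 2 * (1 / sqrt u)" using u by (simp add: ln_div ln_sqrt)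
      then have "u * - ln u \<le> u * (2 * (1 / sqrt u))" using u by (intro mult_left_mono) auto
      also have "\<dots> = 2 * sqrt u" using u by (simp add: real_div_sqrt field_simps)
      finally show ?thesis using u that(2) ln_le_zero_iff[of u]
        by (simp add: abs_mult mult_nonneg_nonpos abs_of_nonpos)
    qed simp
    have "\<forall>\<^sub>F u in at 0 within {0..}. norm (u * ln u) \<le> 2 * sqrt u"
      unfolding eventually_at by (rule exI[of _ 1]) (auto simp: dist_real_def intro!: bd)
    moreover have "((\<lambda>u::real. 2 * sqrt u) \<longlongrightarrow> 0) (at 0 within {0..})"
      by (rule tendsto_eq_intros refl | simp)+
    ultimately show ?thesis using True by (simp add: Lim_null_comparison)
  qed
qed

lemma phi_alt: "phi \<theta> \<beta> x = \<beta> / 2 * ((\<Sum>j=1..\<theta>. (x j)\<^sup>2) - 1) - (\<Sum>j=1..\<theta>. x j * ln (x j))"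
proof -
  have "(if t = 0 then 0 else t * ln t) = t * ln t" for t :: real by simp
  then show ?thesis unfolding phi_def by (simp only:)
qed

text \<open>\<open>Delta\<close> leaves the coordinates outside 1..\<theta> free, so it is not
  compact in the product topology. Its intersection with the box C, which fixes those coordinates at
  0, is compact, and setting them to 0 changes neither membership in \<open>Delta\<close> nor
  \<open>phi\<close>.\<close>

lemma phi_attains_max:
  assumes "\<theta> \<ge> 1"
  shows "\<exists>x\<in>Delta \<theta>. \<forall>y\<in>Delta \<theta>. phi \<theta> \<beta> y \<le> phi \<theta> \<beta> x"
proof -
  define C where "C = PiE UNIV (\<lambda>j. if j \<in> {1..\<theta>} then {0..1::real} else {0})"
  have "compactin (product_topology (\<lambda>_. euclidean) UNIV) C"
    unfolding C_def compactin_PiE by auto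
  then have C: "compact C" by (simp add: euclidean_product_topology)
  have cont [continuous_intros]: "continuous_on A (\<lambda>x. x j)" for A :: "(nat \<Rightarrow> real) set" and j
    by (rule continuous_on_subset[OF continuous_on_product_coordinates]) simp
  have "closed (Delta \<theta>)"
    unfolding Delta_def Ball_def
    by (intro closed_Collect_conj closed_Collect_all closed_Collect_imp closed_Collect_le closed_Collect_eq
        open_Collect_const continuous_intros)
  then have K: "compact (C \<inter> Delta \<theta>)" using C by (rule compact_Int_closed[rotated])
  have trunc: "\<exists>x\<in>C \<inter> Delta \<theta>. phi \<theta> \<beta> y = phi \<theta> \<beta> x" if y: "y \<in> Delta \<theta>" for y
  proof (intro bexI)
    let ?x = "\<lambda>j. if j \<in> {1..\<theta>} then y j else 0"
    have "(\<Sum>j=1..\<theta>. g (?x j)) = (\<Sum>j=1..\<theta>. g (y j))" for g :: "real \<Rightarrow> real"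
      by (rule sum.cong) auto
    from this[of "\<lambda>t. t\<^sup>2"] this[of "\<lambda>t. t * ln t"] show "phi \<theta> \<beta> y = phi \<theta> \<beta> ?x"
      unfolding phi_alt by (simp only:)
    have "?x \<in> C" using y by (auto simp: C_def Delta_def)
    moreover have "?x \<in> Delta \<theta>" using y by (auto simp: Delta_def)
    ultimately show "?x \<in> C \<inter> Delta \<theta>" by simp
  qed
  have "(\<lambda>j. if j = 1 then 1 else 0) \<in> Delta \<theta>"
    using assms by (auto simp: Delta_def)
  then have ne: "C \<inter> Delta \<theta> \<noteq> {}" using trunc by blast
  have ent: "continuous_on (C \<inter> Delta \<theta>) (\<lambda>x. x j * ln (x j))" if "j \<in> {1..\<theta>}" for j
    using that by (intro continuous_on_compose2[OF continuous_on_x_ln_x] cont) (auto simp: Delta_def)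
  have "continuous_on (C \<inter> Delta \<theta>) (phi \<theta> \<beta>)"
    unfolding phi_alt by (rule continuous_on_diff[OF _ continuous_on_sum[OF ent]]) (intro continuous_intros)
  from continuous_attains_sup[OF K ne this] obtain x
    where "x \<in> C \<inter> Delta \<theta>" "\<forall>y\<in>C \<inter> Delta \<theta>. phi \<theta> \<beta> y \<le> phi \<theta> \<beta> x" by blast
  then show ?thesis using trunc by (intro bexI[of _ x]) (metis, simp)
qed

text \<open>Sums of one function over all weights are blind to order, so arbitrary weights can be
  sorted decreasingly into \<open>Delta\<close> without changing energy or entropy.\<close>

lemma sorted_rearrangement:
  fixes y :: "'a \<Rightarrow> real"
  assumes P: "finite P" and y: "\<And>p. p \<in> P \<Longrightarrow> 0 \<le> y p" "(\<Sum>p\<in>P. y p) = 1"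
  obtains x where "x \<in> Delta (card P)" "\<And>g. (\<Sum>j=1..card P. g (x j) :: real) = (\<Sum>p\<in>P. g (y p))"
proof -
  obtain ps where ps: "set ps = P" "distinct ps" using finite_distinct_list[OF P] by auto
  define xs where "xs = rev (sort (map y ps))"
  \<comment> \<open>Coordinates in \<open>Delta\<close> start at 1, list positions at 0.\<close>
  define x where "x j = xs ! (j - 1)" for j
  have len: "length xs = card P" using ps by (simp add: xs_def distinct_card[symmetric])
  have sum_eq: "(\<Sum>j=1..card P. g (x j) :: real) = (\<Sum>p\<in>P. g (y p))" for g
  proof -
    have "(\<Sum>j=1..card P. g (x j)) = (\<Sum>i<card P. g (xs ! i))"
      by (rule sum.reindex_bij_witness[of _ Suc "\<lambda>j. j - 1"]) (auto simp: x_def)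
    also have "\<dots> = sum_list (map g xs)"
      by (simp add: sum_list_sum_nth len atLeast0LessThan)
    also have "\<dots> = sum_mset (image_mset g (mset xs))" by (simp add: sum_mset_sum_list flip: mset_map)
    also have "mset xs = mset (map y ps)" by (simp add: xs_def)
    also have "sum_mset (image_mset g (mset (map y ps))) = sum_list (map (\<lambda>p. g (y p)) ps)"
      by (simp add: sum_mset_sum_list comp_def flip: mset_map)
    also have "\<dots> = (\<Sum>p\<in>P. g (y p))" using ps by (simp add: sum_list_distinct_conv_sum_set)
    finally show ?thesis .
  qed
  have "y p \<le> 1" if "p \<in> P" for p
    using member_le_sum[of p P y] P y that by simp
  then have rng: "0 \<le> x j \<and> x j \<le> 1" if "j \<in> {1..card P}" for j
  proof -
    have "x j \<in> set xs" using that len by (auto simp: x_def)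
    then show ?thesis using y(1) ps(1) \<open>\<And>p. p \<in> P \<Longrightarrow> y p \<le> 1\<close> by (auto simp: xs_def)
  qed
  have srt: "x j \<le> x i" if "1 \<le> i" "i \<le> j" "j \<le> card P" for i j
    using that len sorted_wrt_nth_less[of "(\<ge>)" xs "i - 1" "j - 1"]
    by (cases "i = j") (auto simp: x_def xs_def sorted_wrt_rev)
  have "x \<in> Delta (card P)"
    using rng srt sum_eq[of "\<lambda>t. t"] y(2) by (auto simp: Delta_def)
  then show thesis using sum_eq by (rule that)
qed

section \<open>The limit of the logarithm of the partition function per site\<close>

lemma finite_spins: "finite (spins S)"
  and card_spins: "card (spins S) = theta S"
proof -
  have *: "spins S = (\<lambda>j. - S + real j) ` {..<theta S}" by (auto simp: spins_def)
  show "finite (spins S)" unfolding * by simp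
  show "card (spins S) = theta S" unfolding * by (subst card_image) (auto simp: inj_on_def)
qed

theorem theorem1p1:
  fixes S \<beta> :: real
  assumes "2 * S \<in> \<nat>" and "\<beta> > 0"
  shows "\<exists>x\<in>Delta (theta S).
           (\<forall>y\<in>Delta (theta S). phi (theta S) \<beta> y \<le> phi (theta S) \<beta> x) \<and>
           (\<lambda>n. ln (partition_fn S \<beta> n) / real n) \<longlonglongrightarrow> phi (theta S) \<beta> x"
proof -
  define P where "P = spins S"
  define \<theta> where "\<theta> = theta S"
  have P: "finite P" "card P = \<theta>" by (simp_all add: P_def \<theta>_def finite_spins card_spins)
  obtain x where x: "x \<in> Delta \<theta>" "\<And>y. y \<in> Delta \<theta> \<Longrightarrow> phi \<theta> \<beta> y \<le> phi \<theta> \<beta> x"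
    using phi_attains_max[of \<theta> \<beta>] by (auto simp: \<theta>_def theta_def)
  define M where "M = phi \<theta> \<beta> x"
  \<comment> \<open>The degree of the polynomial factor in the upper bound: one power of n + 1 for
    each raising operator and one for each spin value.\<close>
  define D where "D = real (card (pos_roots P) + \<theta>)"
  have upper: "potts_fun P \<beta> y \<le> M + \<beta> / 2" if y: "\<And>p. p \<in> P \<Longrightarrow> 0 \<le> y p" "(\<Sum>p\<in>P. y p) = 1" for y
  proof -
    obtain z where z: "z \<in> Delta \<theta>" "\<And>g. (\<Sum>j=1..\<theta>. g (z j) :: real) = (\<Sum>p\<in>P. g (y p))"
      using sorted_rearrangement[OF P(1) y] P(2) by auto
    have "phi \<theta> \<beta> z = potts_fun P \<beta> y - \<beta> / 2"
      unfolding phi_alt potts_fun_def z(2)[of "\<lambda>t. t\<^sup>2"] z(2)[of "\<lambda>t. t * ln t"]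
      by (simp add: right_diff_distrib)
    then show ?thesis using x(2)[OF z(1)] by (simp add: M_def)
  qed
  \<comment> \<open>Conversely, the ordered maximiser is carried to the spin values along an
    arbitrary bijection, since \<open>potts_fun\<close> is symmetric in the weights.\<close>
  obtain h where h: "bij_betw h P {1..\<theta>}"
    using P by (metis card_atLeastAtMost diff_Suc_1 finite_atLeastAtMost finite_same_card_bij)
  define y where "y p = x (h p)" for p
  have ysum: "(\<Sum>p\<in>P. g (y p)) = (\<Sum>j=1..\<theta>. g (x j) :: real)" for g
    unfolding y_def using h by (rule sum.reindex_bij_betw)
  have y0: "0 \<le> y p" if "p \<in> P" for p
    using that x(1) bij_betwE[OF h] by (auto simp: y_def Delta_def)
  have y1: "(\<Sum>p\<in>P. y p) = 1" using ysum[of "\<lambda>t. t"] x(1) by (simp add: Delta_def)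
  have ymax: "potts_fun P \<beta> y = M + \<beta> / 2"
    unfolding M_def phi_alt potts_fun_def ysum[of "\<lambda>t. t\<^sup>2"] ysum[of "\<lambda>t. t * ln t"]
    by (simp add: right_diff_distrib)
  have bounds: "M \<le> ln (partition_fn S \<beta> n) / real n \<and>
      ln (partition_fn S \<beta> n) / real n \<le> M + ((\<beta> / 2 + D * ln 2) / real n + D * (ln (real n) / real n))"
    if n: "n > 0" for n
  proof -
    have "exp (real n * M) = exp (- \<beta> * real n / 2) * exp (real n * potts_fun P \<beta> y)"
      by (simp add: ymax algebra_simps flip: exp_add)
    also have "\<dots> \<le> exp (- \<beta> * real n / 2) * potts_sum P \<beta> n"
      using n assms(2) P(1) y0 y1 by (intro mult_left_mono potts_sum_ge) auto
    also have "\<dots> \<le> partition_fn S \<beta> n"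
      using partition_fn_bounds(1)[OF n, of \<beta> S] assms(2) by (simp add: P_def finite_spins)
    finally have lo: "exp (real n * M) \<le> partition_fn S \<beta> n" .
    then have pos: "partition_fn S \<beta> n > 0" by (rule less_le_trans[OF exp_gt_zero])
    have "partition_fn S \<beta> n \<le> real (Suc n) ^ card (pos_roots P) * exp (\<beta> / 2 - \<beta> * real n / 2) * potts_sum P \<beta> n"
      using partition_fn_bounds(2)[OF n, of \<beta> S] assms(2) by (simp add: P_def finite_spins)
    also have "\<dots> \<le> real (Suc n) ^ card (pos_roots P) * exp (\<beta> / 2 - \<beta> * real n / 2)
        * (real (Suc n) ^ \<theta> * exp (real n * (M + \<beta> / 2)))"
      using potts_sum_le[OF n P(1) upper] P(2) by (intro mult_left_mono) auto
    also have "\<dots> = real (Suc n) ^ (card (pos_roots P) + \<theta>) * (exp (\<beta> / 2 - \<beta> * real n / 2) * exp (real n * (M + \<beta> / 2)))"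
      by (simp only: power_add mult_ac)
    also have "exp (\<beta> / 2 - \<beta> * real n / 2) * exp (real n * (M + \<beta> / 2)) = exp (\<beta> / 2 + real n * M)"
      unfolding exp_add[symmetric] by (simp add: algebra_simps)
    finally have "ln (partition_fn S \<beta> n) \<le> ln (real (Suc n) ^ (card (pos_roots P) + \<theta>) * exp (\<beta> / 2 + real n * M))"
      using pos by (intro ln_mono) auto
    also have "\<dots> = D * ln (real (Suc n)) + (\<beta> / 2 + real n * M)"
      by (simp add: ln_mult ln_realpow D_def del: of_nat_Suc of_nat_add)
    also have "\<dots> \<le> D * (ln 2 + ln (real n)) + (\<beta> / 2 + real n * M)"
    proof -
      \<comment> \<open>Replacing n + 1 by 2 n brings the error into the form ln n / n, which tends
        to 0.\<close>
      have "ln (real (Suc n)) \<le> ln (2 * real n)" using n by (intro ln_mono) auto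
      also have "\<dots> = ln 2 + ln (real n)" using n by (simp add: ln_mult)
      finally show ?thesis by (intro add_right_mono mult_left_mono) (simp_all add: D_def)
    qed
    finally have hi: "ln (partition_fn S \<beta> n) / real n \<le> (D * (ln 2 + ln (real n)) + (\<beta> / 2 + real n * M)) / real n"
      using n by (intro divide_right_mono) auto
    have "real n * M \<le> ln (partition_fn S \<beta> n)" using lo pos by (simp add: ln_ge_iff)
    then show ?thesis using hi n by (auto simp: field_simps)
  qed
  have "(\<lambda>n. M + ((\<beta> / 2 + D * ln 2) / real n + D * (ln (real n) / real n))) \<longlonglongrightarrow> M + (0 + D * 0)"
    by (intro tendsto_intros lim_ln_over_n lim_const_over_n)
  then have lim: "(\<lambda>n. M + ((\<beta> / 2 + D * ln 2) / real n + D * (ln (real n) / real n))) \<longlonglongrightarrow> M"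
    by (simp only: mult_zero_right add_0_right)
  have "(\<lambda>n. ln (partition_fn S \<beta> n) / real n) \<longlonglongrightarrow> M"
  proof (rule tendsto_sandwich[OF _ _ tendsto_const lim])
    show "\<forall>\<^sub>F n in sequentially. M \<le> ln (partition_fn S \<beta> n) / real n"
      by (rule eventually_sequentiallyI[of 1]) (simp add: bounds)
    show "\<forall>\<^sub>F n in sequentially. ln (partition_fn S \<beta> n) / real n
        \<le> M + ((\<beta> / 2 + D * ln 2) / real n + D * (ln (real n) / real n))"
      by (rule eventually_sequentiallyI[of 1]) (simp only: bounds Suc_le_eq One_nat_def)
  qed
  then show ?thesis using x by (intro bexI[of _ x]) (auto simp: M_def \<theta>_def)
qed

end
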